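(* Let $m\in\mathbb N$, $\alpha\in[0,1]$, $\beta\in(0,1]$ and let $Z\subseteq\mathbb R^n$ be convex. Assume that: (a) there exists a continuous function $\tilde h:\Omega_1^2\to\mathbb R_+$ such that $\int_\Omega|k(x,y)-k(x_0,y)|\,d\mu(y)\le\tilde h(x,x_0)d(x,x_0)^\beta$ for all $x,x_0\in\Omega_1$; (b) $k(x,\cdot)$ is measurable for all $x\in\Omega_1$ and $\sup_{\xi\in\Omega_1}\int_\Omega|k(\xi,y)|\,d\mu(y)<\infty$; (c) for every $0\le j\le m$ the partial derivative $D_2^jg:\Omega\times Z\to L_j(\mathbb R^n,\mathbb R^p)$ exists and can be continuously extended to $\Omega\times\overline Z$. Then the Hammerstein operator $\mathscr H:U_\alpha\to C^\beta_d(\Omega_1)$, $\mathscr H(u):=\int_\Omega k(\cdot,y)g(y,u(y))\,d\mu(y)$, is $m$-times continuously differentiable with $D^j\mathscr H=\mathscr K\mathscr G^j$ for every $1\le j\le m$, that is, $$D^j\mathscr H(u)v_1\cdots v_j=\int_\Omega k(\cdot,y)D_2^jg(y,u(y))v_1(y)\cdots v_j(y)\,d\mu(y)\quad\text{for all }u\in U_\alpha,\ v_1,\ldots,v_j\in C^\alpha_n(\Omega).$$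
   Context: Notation: $\mathbb R_+=[0,\infty)$; $|\cdot|$ denotes norms on finite-dimensional spaces, with the norm on matrices $\mathbb R^{d\times p}$ compatible with the vector norms ($|Aw|\le|A||w|$); $d(\cdot,\cdot)$ denotes the metric of any metric space considered, while $d$ alone is a dimension. For normed spaces $X,Y$, $L_j(X,Y)$ is the normed space of continuous $j$-linear maps $X^j\to Y$, $L_0(X,Y):=Y$. For a metric space $X$ and $m\in\mathbb N$, $C^0_m(X)$ is the space of bounded continuous $u:X\to\mathbb R^m$ with norm $\|u\|_0=\sup_{x\in X}|u(x)|$. For $\alpha\in(0,1]$, $[u]_\alpha:=\sup_{x\neq\bar x}|u(x)-u(\bar x)|/d(x,\bar x)^\alpha$, and $C^\alpha_m(X)$ is the space of bounded $u:X\to\mathbb R^m$ with $[u]_\alpha<\infty$, normed by $\|u\|_\alpha=\max\{\|u\|_0,[u]_\alpha\}$. Setting: $\Omega,\Omega_1$ are metric spaces, $\Omega$ is compact, $(\Omega,\mathfrak A,\mu)$ is a measure space with $\mu(\Omega)<\infty$ whose $\sigma$-algebra contains the Borel sets; measurability and integrability refer to it. $Z\subseteq\mathbb R^n$ is nonempty, $U_\alpha:=\{u:\Omega\to Z\mid u\in C^\alpha_n(\Omega)\}$, $k:\Omega_1\times\Omega\to\mathbb R^{d\times p}$ and $g:\Omega\times Z\to\mathbb R^p$ are functions. $\mathscr K w:=\int_\Omega k(\cdot,y)w(y)\,d\mu(y)$ is the Fredholm operator on $C^0_p(\Omega)$, and $(\mathscr G^j(u)v_1\cdots v_j)(x):=D_2^jg(x,u(x))v_1(x)\cdots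 v_j(x)$. Derivatives of $g$ in its second variable: $D_2^0g=g$; at interior points of $Z$ they are Fréchet derivatives; at a non-interior point $z_0\in Z$ it is assumed that $g$ has an extension to $\Omega\times(Z\cup V)$, with $V\subseteq\mathbb R^n$ a neighborhood of $z_0$, whose partial derivatives exist at $z_0$ as required. Differentiability of an operator $F$ on $U_\alpha$ (into a normed space) at $u\in U_\alpha$ with derivative $F'(u)$ means $\|F(u+h)-F(u)-F'(u)h\|=o(\|h\|_\alpha)$ for $h\in C^\alpha_n(\Omega)$ with $u+h\in U_\alpha$, $h\to0$; $m$-fold continuous differentiability with given derivatives is understood successively in this sense, with derivatives continuous as maps $U_\alpha\to L_j(C^\alpha_n(\Omega),C^\beta_d(\Omega_1))$.
   Formalization: The function h̃ in (a) is additionally assumed bounded (automatic for compact Ω₁); without this the claim fails, e.g. Ω a point with Dirac measure, Ω₁=ℝ, β=1, g=1, k(x)=sin(x²), h̃(x,x₀)=|x+x₀|, where H(u) is not Lipschitz. *)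

theory Defs
  imports "HOL-Analysis.Analysis" "HOL-Library.Function_Algebras"
begin

section \<open>Pointwise vector space structure on functions\<close>

text \<open>Addition, subtraction and zero come from \<^theory>\<open>HOL-Library.Function_Algebras\<close>.\<close>

instantiation "fun" :: (type, real_vector) real_vector
begin

definition scaleR_fun :: "real \<Rightarrow> ('a \<Rightarrow> 'b) \<Rightarrow> 'a \<Rightarrow> 'b"
  where "scaleR_fun r f = (\<lambda>x. r *\<^sub>R f x)"

instance
  by standard (simp_all add: scaleR_fun_def fun_eq_iff scaleR_add_right scaleR_add_left)

end

section \<open>Normed spaces given by a carrier and a norm\<close>

text \<open>
  Hoelder spaces depend on a real exponent and spaces of multilinear maps on a natural number,
  so normed spaces are represented by a carrier set \<open>X\<close> and a norm function \<open>NX\<close>.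
  The norms on the finite-dimensional spaces are arbitrary as well; topological notions there
  (continuity, interior, closure) are those of the library, since all such norms are equivalent.
\<close>

definition vector_norm :: "('x::real_vector \<Rightarrow> real) \<Rightarrow> bool" where
  "vector_norm N \<longleftrightarrow>
     (\<forall>x. N x = 0 \<longleftrightarrow> x = 0) \<and>
     (\<forall>x y. N (x + y) \<le> N x + N y) \<and>
     (\<forall>c x. N (c *\<^sub>R x) = \<bar>c\<bar> * N x)"

text \<open>
  A \<open>j\<close>-linear map takes the list of its \<open>j\<close> arguments; its values on lists of other lengths, or
  with entries outside the carrier, are irrelevant.
\<close>

definition args :: "nat \<Rightarrow> 'x set \<Rightarrow> 'x list set" where
  "args j X = {vs. length vs = j \<and> set vs \<subseteq> X}"

definition multilin_space ::
  "nat \<Rightarrow> 'x::real_vector set \<Rightarrow> ('x \<Rightarrow> real) \<Rightarrow> 'y::real_vector set \<Rightarrow> ('y \<Rightarrow> real)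
    \<Rightarrow> ('x list \<Rightarrow> 'y) set" where
  "multilin_space j X NX Y NY = {f.
     (\<forall>vs\<in>args j X. f vs \<in> Y) \<and>
     (\<forall>vs\<in>args j X. \<forall>i<j. \<forall>a\<in>X. \<forall>b\<in>X. \<forall>r s.
        f (vs[i := r *\<^sub>R a + s *\<^sub>R b]) = r *\<^sub>R f (vs[i := a]) + s *\<^sub>R f (vs[i := b])) \<and>
     (\<exists>C. \<forall>vs\<in>args j X. NY (f vs) \<le> C * (\<Prod>v\<leftarrow>vs. NX v))}"

definition multilin_norm ::
  "nat \<Rightarrow> 'x set \<Rightarrow> ('x \<Rightarrow> real) \<Rightarrow> ('y \<Rightarrow> real) \<Rightarrow> ('x list \<Rightarrow> 'y) \<Rightarrow> real" where
  "multilin_norm j X NX NY f = (SUP vs\<in>{vs\<in>args j X. \<forall>v\<in>set vs. NX v \<le> 1}. NY (f vs))"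

text \<open>
  \<open>F (u + h) - F u - F' h\<close> is \<open>o(NX h)\<close> in the norm \<open>NW\<close>, for increments \<open>h \<in> X\<close> with
  \<open>u + h \<in> U\<close>; the set \<open>U\<close> need not be open.
\<close>

definition frechet_within ::
  "'x::real_vector set \<Rightarrow> ('x \<Rightarrow> real) \<Rightarrow> 'x set \<Rightarrow> ('w::real_vector \<Rightarrow> real)
    \<Rightarrow> ('x \<Rightarrow> 'w) \<Rightarrow> ('x \<Rightarrow> 'w) \<Rightarrow> 'x \<Rightarrow> bool" where
  "frechet_within X NX U NW F F' u \<longleftrightarrow>
     (\<forall>\<epsilon>>0. \<exists>\<delta>>0. \<forall>h\<in>X. u + h \<in> U \<and> NX h < \<delta> \<longrightarrow>
        NW (F (u + h) - F u - F' h) \<le> \<epsilon> * NX h)"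

definition norm_continuous_on ::
  "'x::real_vector set \<Rightarrow> ('x \<Rightarrow> real) \<Rightarrow> ('w::real_vector \<Rightarrow> real) \<Rightarrow> ('x \<Rightarrow> 'w) \<Rightarrow> bool" where
  "norm_continuous_on U NX NW F \<longleftrightarrow>
     (\<forall>u\<in>U. \<forall>\<epsilon>>0. \<exists>\<delta>>0. \<forall>u'\<in>U. NX (u' - u) < \<delta> \<longrightarrow> NW (F u' - F u) < \<epsilon>)"

text \<open>
  \<open>F : U \<rightarrow> Y\<close> is \<open>m\<close>-times continuously differentiable on \<open>U \<subseteq> X\<close> with derivatives \<open>D j\<close>.
  The derivative of \<open>D j\<close> at \<open>u\<close>, a linear map from \<open>X\<close> into the \<open>j\<close>-linear maps, is identified
  with the \<open>(j+1)\<close>-linear map \<open>D (Suc j) u\<close>, the new direction being the first argument.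
\<close>

definition cont_differentiable ::
  "nat \<Rightarrow> 'x::real_vector set \<Rightarrow> ('x \<Rightarrow> real) \<Rightarrow> 'x set \<Rightarrow> 'y::real_vector set \<Rightarrow> ('y \<Rightarrow> real)
    \<Rightarrow> ('x \<Rightarrow> 'y) \<Rightarrow> (nat \<Rightarrow> 'x \<Rightarrow> 'x list \<Rightarrow> 'y) \<Rightarrow> bool" where
  "cont_differentiable m X NX U Y NY F D \<longleftrightarrow>
     (\<forall>u\<in>U. D 0 u [] = F u) \<and>
     (\<forall>j\<le>m. \<forall>u\<in>U. D j u \<in> multilin_space j X NX Y NY) \<and>
     (\<forall>j<m. \<forall>u\<in>U. frechet_within X NX U (multilin_norm j X NX NY)
        (D j) (\<lambda>h vs. D (Suc j) u (h # vs)) u) \<and>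
     (\<forall>j\<le>m. norm_continuous_on U NX (multilin_norm j X NX NY) (D j))"

section \<open>Hoelder spaces\<close>

definition sup_norm :: "('v \<Rightarrow> real) \<Rightarrow> ('a \<Rightarrow> 'v) \<Rightarrow> ennreal" where
  "sup_norm N u = (SUP x. ennreal (N (u x)))"

definition holder_seminorm ::
  "real \<Rightarrow> ('v::real_vector \<Rightarrow> real) \<Rightarrow> ('a::metric_space \<Rightarrow> 'v) \<Rightarrow> ennreal" where
  "holder_seminorm \<alpha> N u =
     (SUP (x, x')\<in>{(x, x'). x \<noteq> x'}. ennreal (N (u x - u x') / dist x x' powr \<alpha>))"

text \<open>For \<open>\<alpha> = 0\<close> the space consists of the bounded continuous functions with the sup norm.\<close>

definition holder_enorm ::
  "real \<Rightarrow> ('v::real_vector \<Rightarrow> real) \<Rightarrow> ('a::metric_space \<Rightarrow> 'v) \<Rightarrow> ennreal" where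
  "holder_enorm \<alpha> N u =
     (if \<alpha> = 0 then sup_norm N u else max (sup_norm N u) (holder_seminorm \<alpha> N u))"

definition holder_space ::
  "real \<Rightarrow> ('v::real_normed_vector \<Rightarrow> real) \<Rightarrow> ('a::metric_space \<Rightarrow> 'v) set" where
  "holder_space \<alpha> N = {u. (\<alpha> = 0 \<longrightarrow> continuous_on UNIV u) \<and> holder_enorm \<alpha> N u < \<infinity>}"

definition holder_norm ::
  "real \<Rightarrow> ('v::real_vector \<Rightarrow> real) \<Rightarrow> ('a::metric_space \<Rightarrow> 'v) \<Rightarrow> real" where
  "holder_norm \<alpha> N u = enn2real (holder_enorm \<alpha> N u)"

definition holder_into ::
  "real \<Rightarrow> ('v::real_normed_vector \<Rightarrow> real) \<Rightarrow> 'v set \<Rightarrow> ('a::metric_space \<Rightarrow> 'v) set" where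
  "holder_into \<alpha> N Z = {u \<in> holder_space \<alpha> N. \<forall>x. u x \<in> Z}"

section \<open>Partial derivatives with respect to the second variable\<close>

text \<open>
  \<open>Dg j\<close> is the \<open>j\<close>-th partial derivative of \<open>g\<close> on \<open>\<Omega> \<times> Z\<close>, where \<open>\<Omega>\<close> is the whole type \<open>'a\<close>;
  values of \<open>g\<close> and \<open>Dg j\<close> off \<open>Z\<close> are irrelevant. At a non-interior point of \<open>Z\<close> the derivative
  is that of some extension to \<open>\<Omega> \<times> (Z \<union> V)\<close>, \<open>V\<close> a neighbourhood of the point. For \<open>j > 0\<close> it is
  \<open>Dg j\<close> itself which is extended. This holds whenever \<open>g\<close> has an extension whose partial
  derivatives are consistent with \<open>Dg\<close> on \<open>Z\<close>; without consistency, \<open>Dg (Suc j)\<close> would be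
  unrelated to \<open>Dg j\<close> if \<open>Z\<close> has empty interior.
\<close>

definition partial_derivatives ::
  "(('n::real_normed_vector) \<Rightarrow> real) \<Rightarrow> ('p::real_vector \<Rightarrow> real) \<Rightarrow> 'n set \<Rightarrow> nat
    \<Rightarrow> ('a \<Rightarrow> 'n \<Rightarrow> 'p) \<Rightarrow> (nat \<Rightarrow> 'a \<Rightarrow> 'n \<Rightarrow> 'n list \<Rightarrow> 'p) \<Rightarrow> bool" where
  "partial_derivatives Nn Np Z m g Dg \<longleftrightarrow>
     (\<forall>y. \<forall>z\<in>Z. Dg 0 y z [] = g y z) \<and>
     (\<forall>j\<le>m. \<forall>y. \<forall>z\<in>Z. Dg j y z \<in> multilin_space j UNIV Nn UNIV Np) \<and>
     (\<forall>j<m. \<forall>z\<in>Z.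
        if z \<in> interior Z
        then \<forall>y. frechet_within UNIV Nn Z (multilin_norm j UNIV Nn Np)
               (Dg j y) (\<lambda>h vs. Dg (Suc j) y z (h # vs)) z
        else \<exists>V G. z \<in> interior V \<and>
               (\<forall>y. (\<forall>x\<in>Z. G y x = Dg j y x) \<and>
                    (\<forall>x\<in>Z \<union> V. G y x \<in> multilin_space j UNIV Nn UNIV Np) \<and>
                    frechet_within UNIV Nn (Z \<union> V) (multilin_norm j UNIV Nn Np)
                      (G y) (\<lambda>h vs. Dg (Suc j) y z (h # vs)) z))"

definition continuously_extends ::
  "nat \<Rightarrow> (('n::real_normed_vector) \<Rightarrow> real) \<Rightarrow> ('p::real_vector \<Rightarrow> real) \<Rightarrow> 'n set
    \<Rightarrow> ('a::metric_space \<Rightarrow> 'n \<Rightarrow> 'n list \<Rightarrow> 'p) \<Rightarrow> bool" where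
  "continuously_extends j Nn Np Z f \<longleftrightarrow>
     (\<exists>E. (\<forall>y. \<forall>z\<in>Z. E y z = f y z) \<and>
          (\<forall>y. \<forall>z\<in>closure Z. E y z \<in> multilin_space j UNIV Nn UNIV Np) \<and>
          (\<forall>y0. \<forall>z0\<in>closure Z.
             ((\<lambda>(y, z). multilin_norm j UNIV Nn Np (E y z - E y0 z0)) \<longlongrightarrow> 0)
               (at (y0, z0) within UNIV \<times> closure Z)))"

section \<open>Integral and substitution operators\<close>

definition fredholm ::
  "'a measure \<Rightarrow> ('b \<Rightarrow> 'a \<Rightarrow> real^'p^'d) \<Rightarrow> ('a \<Rightarrow> real^'p) \<Rightarrow> 'b \<Rightarrow> real^'d" where
  "fredholm M k w = (\<lambda>x. \<integral>y. k x y *v w y \<partial>M)"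

definition nemytskii ::
  "(nat \<Rightarrow> 'a \<Rightarrow> 'n \<Rightarrow> 'n list \<Rightarrow> 'p) \<Rightarrow> nat \<Rightarrow> ('a \<Rightarrow> 'n) \<Rightarrow> ('a \<Rightarrow> 'n) list \<Rightarrow> 'a \<Rightarrow> 'p" where
  "nemytskii Dg j u vs = (\<lambda>x. Dg j x (u x) (map (\<lambda>v. v x) vs))"

definition hammerstein ::
  "'a measure \<Rightarrow> ('b \<Rightarrow> 'a \<Rightarrow> real^'p^'d) \<Rightarrow> ('a \<Rightarrow> 'n \<Rightarrow> real^'p) \<Rightarrow> ('a \<Rightarrow> 'n) \<Rightarrow> 'b \<Rightarrow> real^'d" where
  "hammerstein M k g u = (\<lambda>x. \<integral>y. k x y *v g y (u y) \<partial>M)"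

end

theory Submission
  imports Defs
begin

text \<open>
  The Hammerstein operator is the composition of a substitution operator with the linear Fredholm
  operator. Because \<open>\<Omega>\<close> is compact, the graph \<open>{(y, u y) | y \<in> \<Omega>}\<close> of a continuous \<open>u\<close> is compact,
  and the partial derivatives of \<open>g\<close>, being continuous, are uniformly continuous along it
  (\<open>uniform_near_graph\<close>). With the mean value inequality on segments in the convex set \<open>Z\<close>
  (\<open>partial_derivative_remainder\<close>), the substitution operators are therefore continuously
  differentiable with respect to the sup norm: the Taylor remainder at \<open>y\<close> in direction \<open>h\<close> is at
  most \<open>\<epsilon> |h y| |v\<^sub>1 y| \<dots> |v\<^sub>j y|\<close>, uniformly in \<open>y\<close>, once \<open>h\<close> is small in the sup norm.

  Estimates in the sup norm suffice, as the Fredholm operator maps continuous functions into the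
  Hoelder space of exponent \<open>\<beta>\<close>, with a norm controlled by the sup norm of the argument
  (\<open>fredholm_holder_bound\<close>): the Hoelder condition on \<open>k\<close> in its first variable supplies the
  regularity. In the domain, functions of finite Hoelder norm are continuous and their norm
  dominates the sup norm, so that the two steps compose (\<open>hammerstein_cont_differentiable\<close>).

  The arbitrary norms on the finite-dimensional spaces are compared with the Euclidean ones,
  because all claims are insensitive to constant factors.
\<close>

section \<open>Norms on finite-dimensional spaces\<close>

lemma vector_norm_zero: "vector_norm N \<Longrightarrow> N 0 = 0"
  by (simp add: vector_norm_def)

lemma vector_norm_scaleR: "vector_norm N \<Longrightarrow> N (c *\<^sub>R x) = \<bar>c\<bar> * N x"
  by (simp add: vector_norm_def)

lemma vector_norm_triangle: "vector_norm N \<Longrightarrow> N (x + y) \<le> N x + N y"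
  by (simp add: vector_norm_def)

lemma vector_norm_minus: "vector_norm N \<Longrightarrow> N (- x) = N x"
  using vector_norm_scaleR[of N "-1" x] by simp

lemma vector_norm_diff_le: "vector_norm N \<Longrightarrow> N (x - y) \<le> N x + N y"
  using vector_norm_triangle[of N x "- y"] by (simp add: vector_norm_minus)

lemma vector_norm_nonneg: "vector_norm N \<Longrightarrow> 0 \<le> N x"
  using vector_norm_diff_le[of N x x] by (simp add: vector_norm_zero)

lemma vector_norm_pos: "vector_norm N \<Longrightarrow> x \<noteq> 0 \<Longrightarrow> 0 < N x"
  using vector_norm_nonneg[of N x] by (auto simp: vector_norm_def order_less_le)

lemma vector_norm_le_norm:
  fixes N :: "'x::euclidean_space \<Rightarrow> real"
  assumes N: "vector_norm N"
  shows "N x \<le> (\<Sum>b\<in>Basis. N b) * norm x"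
proof -
  have sum: "N (\<Sum>b\<in>B. f b) \<le> (\<Sum>b\<in>B. N (f b))" if "finite B" for B and f :: "'x \<Rightarrow> 'x"
    using that
  proof induction
    case (insert b B)
    then show ?case
      using vector_norm_triangle[OF N, of "f b" "sum f B"] by simp
  qed (simp add: vector_norm_zero[OF N])
  have "N x = N (\<Sum>b\<in>Basis. (x \<bullet> b) *\<^sub>R b)"
    by (simp add: euclidean_representation)
  also have "\<dots> \<le> (\<Sum>b\<in>Basis. N ((x \<bullet> b) *\<^sub>R b))"
    by (rule sum) simp
  also have "\<dots> \<le> (\<Sum>b\<in>Basis. norm x * N b)"
    by (intro sum_mono)
      (simp add: vector_norm_scaleR[OF N] mult_right_mono vector_norm_nonneg[OF N] Basis_le_norm)
  finally show ?thesis
    by (simp add: sum_distrib_left mult.commute)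
qed

lemma continuous_on_vector_norm:
  fixes N :: "'x::euclidean_space \<Rightarrow> real"
  assumes N: "vector_norm N"
  shows "continuous_on S N"
proof -
  let ?K = "\<Sum>b\<in>Basis. N b"
  have "\<bar>N x - N y\<bar> \<le> ?K * norm (x - y)" for x y
    using vector_norm_triangle[OF N, of "x - y" y] vector_norm_triangle[OF N, of "y - x" x]
      vector_norm_le_norm[OF N, of "x - y"] vector_norm_le_norm[OF N, of "y - x"]
    by (simp add: norm_minus_commute)
  moreover have "((\<lambda>y. ?K * norm (y - x)) \<longlongrightarrow> ?K * norm (x - x)) (at x within S)" for x
    by (intro tendsto_intros)
  ultimately have "((\<lambda>y. N y - N x) \<longlongrightarrow> 0) (at x within S)" for x
    using Lim_null_comparison[of "\<lambda>y. N y - N x" "\<lambda>y. ?K * norm (y - x)"] by simp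
  then show ?thesis
    unfolding continuous_on_def using LIM_zero_cancel by blast
qed

text \<open>
  All norms on a finite-dimensional space are equivalent: \<open>N\<close> attains a positive minimum on the
  compact Euclidean unit sphere. A single constant for both directions keeps the later estimates
  short.
\<close>

lemma vector_norm_equivalent:
  fixes N :: "'x::euclidean_space \<Rightarrow> real"
  assumes N: "vector_norm N"
  obtains C where "C > 0" "\<And>x. N x \<le> C * norm x" "\<And>x. norm x \<le> C * N x"
proof -
  obtain b :: 'x where "b \<in> Basis"
    using nonempty_Basis by blast
  then have "sphere (0::'x) 1 \<noteq> {}"
    by (auto intro!: exI[of _ b])
  then obtain e where e: "e \<in> sphere 0 1" and min: "\<And>x. x \<in> sphere 0 1 \<Longrightarrow> N e \<le> N x"
    using continuous_attains_inf[OF compact_sphere _ continuous_on_vector_norm[OF N]] by metis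
  have "N e > 0"
    using e vector_norm_pos[OF N, of e] by force
  have low: "norm x \<le> 1 / N e * N x" for x
  proof (cases "x = 0")
    case False
    then have "N e \<le> N ((1 / norm x) *\<^sub>R x)"
      by (intro min) simp
    with False \<open>N e > 0\<close> show ?thesis
      by (simp add: vector_norm_scaleR[OF N] field_simps)
  qed (simp add: vector_norm_zero[OF N])
  define C where "C = (\<Sum>b\<in>Basis. N b) + 1 / N e"
  have K: "0 \<le> (\<Sum>b\<in>Basis. N b)"
    by (intro sum_nonneg vector_norm_nonneg[OF N])
  show ?thesis
  proof
    show "C > 0"
      using K \<open>N e > 0\<close> by (simp add: C_def add_nonneg_pos)
    show "N x \<le> C * norm x" for x
      by (rule order_trans[OF vector_norm_le_norm[OF N]])
        (use \<open>N e > 0\<close> in \<open>simp add: C_def mult_right_mono\<close>)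
    show "norm x \<le> C * N x" for x
      by (rule order_trans[OF low])
        (use K in \<open>simp add: C_def distrib_right vector_norm_nonneg[OF N]\<close>)
  qed
qed

section \<open>Multilinear maps\<close>

lemma multilin_update:
  assumes "f \<in> multilin_space j UNIV NX Y NY" "length vs = j" "i < j"
  shows "f (vs[i := r *\<^sub>R a + s *\<^sub>R b]) = r *\<^sub>R f (vs[i := a]) + s *\<^sub>R f (vs[i := b])"
  using assms by (auto simp: multilin_space_def args_def)

lemma multilin_bounded:
  assumes "f \<in> multilin_space j X NX Y NY"
  obtains C where "\<And>vs. vs \<in> args j X \<Longrightarrow> NY (f vs) \<le> C * (\<Prod>v\<leftarrow>vs. NX v)"
  using assms unfolding multilin_space_def by blast

lemma multilin_zero_entry:
  assumes "f \<in> multilin_space j UNIV NX Y NY" "length vs = j" "0 \<in> set vs"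
  shows "f vs = 0"
proof -
  obtain i where "i < j" "vs ! i = 0"
    using assms by (auto simp: in_set_conv_nth)
  then show ?thesis
    using multilin_update[OF assms(1,2), of i 0 0 0 0] assms(2)
    by (metis add.right_neutral list_update_id scale_zero_left)
qed

text \<open>
  The arguments are scaled one after another, from the left; the induction counts those already
  scaled.
\<close>

lemma multilin_scale_entries:
  assumes f: "f \<in> multilin_space j UNIV NX Y NY" and len: "length vs = j"
  shows "f (map (\<lambda>v. c v *\<^sub>R v) vs) = (\<Prod>v\<leftarrow>vs. c v) *\<^sub>R f vs"
proof -
  have "f (map (\<lambda>v. c v *\<^sub>R v) (take i vs) @ drop i vs) = (\<Prod>v\<leftarrow>take i vs. c v) *\<^sub>R f vs"
    if "i \<le> j" for i
    using that
  proof (induction i)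
    case (Suc i)
    let ?ws = "map (\<lambda>v. c v *\<^sub>R v) (take i vs) @ drop i vs"
    have drop: "drop i vs = vs ! i # drop (Suc i) vs"
      using Suc.prems len by (simp add: Cons_nth_drop_Suc)
    have "map (\<lambda>v. c v *\<^sub>R v) (take (Suc i) vs) @ drop (Suc i) vs
        = ?ws[i := c (vs ! i) *\<^sub>R vs ! i + 0 *\<^sub>R 0]"
      using Suc.prems len by (simp add: take_Suc_conv_app_nth drop list_update_append)
    also have "f \<dots> = c (vs ! i) *\<^sub>R f (?ws[i := vs ! i])"
      using Suc.prems len by (subst multilin_update[OF f]) auto
    also have "?ws[i := vs ! i] = ?ws"
      using Suc.prems len by (simp add: drop list_update_append)
    finally show ?case
      using Suc len by (simp add: take_Suc_conv_app_nth)
  qed simp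
  from this[of j] show ?thesis
    using len by simp
qed

lemma prod_list_vector_norm_nonneg: "vector_norm N \<Longrightarrow> 0 \<le> (\<Prod>v\<leftarrow>vs. N v)"
  by (induction vs) (auto simp: vector_norm_nonneg)

text \<open>
  The operator norm is a supremum in \<open>real\<close>, which is meaningful only for sets that are bounded
  above; the boundedness condition in \<open>multilin_space\<close> provides this.
\<close>

lemma multilin_norm_bdd_above:
  assumes "vector_norm NX" "f \<in> multilin_space j X NX Y NY"
  shows "bdd_above ((\<lambda>vs. NY (f vs)) ` {vs \<in> args j X. \<forall>v\<in>set vs. NX v \<le> 1})"
proof -
  obtain C where C: "\<And>vs. vs \<in> args j X \<Longrightarrow> NY (f vs) \<le> C * (\<Prod>v\<leftarrow>vs. NX v)"
    using multilin_bounded[OF assms(2)] by blast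
  have prod_le_1: "\<forall>v\<in>set vs. NX v \<le> 1 \<Longrightarrow> (\<Prod>v\<leftarrow>vs. NX v) \<le> 1" for vs
    by (induction vs)
      (auto intro!: mult_le_one prod_list_vector_norm_nonneg assms(1))
  show ?thesis
  proof (rule bdd_aboveI2[of _ _ "\<bar>C\<bar>"])
    fix vs assume "vs \<in> {vs \<in> args j X. \<forall>v\<in>set vs. NX v \<le> 1}"
    then have "NY (f vs) \<le> C * (\<Prod>v\<leftarrow>vs. NX v)" "(\<Prod>v\<leftarrow>vs. NX v) \<le> 1"
      by (auto intro: C prod_le_1)
    moreover have "C * (\<Prod>v\<leftarrow>vs. NX v) \<le> \<bar>C\<bar> * (\<Prod>v\<leftarrow>vs. NX v)"
      by (intro mult_right_mono prod_list_vector_norm_nonneg assms(1)) auto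
    moreover have "\<bar>C\<bar> * (\<Prod>v\<leftarrow>vs. NX v) \<le> \<bar>C\<bar> * 1"
      using calculation(2) by (intro mult_left_mono) auto
    ultimately show "NY (f vs) \<le> \<bar>C\<bar>"
      by linarith
  qed
qed

text \<open>
  By homogeneity in each argument, the supremum over the unit ball controls all values. If an
  argument is \<open>0\<close>, it cannot be normalised, but then both sides vanish.
\<close>

lemma multilin_norm_bound:
  assumes NX: "vector_norm NX" and NY: "vector_norm NY"
    and f: "f \<in> multilin_space j UNIV NX UNIV NY" and len: "length vs = j"
  shows "NY (f vs) \<le> multilin_norm j UNIV NX NY f * (\<Prod>v\<leftarrow>vs. NX v)"
proof (cases "0 \<in> set vs")
  case True
  then have "(\<Prod>v\<leftarrow>vs. NX v) = 0"
    by (force simp: prod_list_zero_iff vector_norm_zero[OF NX] image_iff)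
  with True show ?thesis
    using multilin_zero_entry[OF f len] by (simp add: vector_norm_zero[OF NY])
next
  case False
  let ?ws = "map (\<lambda>v. (1 / NX v) *\<^sub>R v) vs"
  have P: "(\<Prod>v\<leftarrow>vs. 1 / NX v) * (\<Prod>v\<leftarrow>vs. NX v) = 1"
    using False
  proof (induction vs)
    case (Cons v vs)
    then have "NX v \<noteq> 0"
      by (metis list.set_intros(1) vector_norm_pos[OF NX] less_irrefl)
    with Cons show ?case by (simp add: mult.assoc)
  qed simp
  have Pn: "0 \<le> (\<Prod>v\<leftarrow>vs. 1 / NX v)"
    by (induction vs) (auto simp: vector_norm_nonneg[OF NX])
  have "NX ((1 / NX v) *\<^sub>R v) \<le> 1" for v
    by (simp add: vector_norm_scaleR[OF NX] vector_norm_nonneg[OF NX])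
  then have "?ws \<in> {vs \<in> args j UNIV. \<forall>v\<in>set vs. NX v \<le> 1}"
    using len by (auto simp: args_def)
  then have "NY (f ?ws) \<le> multilin_norm j UNIV NX NY f"
    unfolding multilin_norm_def by (rule cSUP_upper) (rule multilin_norm_bdd_above[OF NX f])
  then have "(\<Prod>v\<leftarrow>vs. 1 / NX v) * NY (f vs) \<le> multilin_norm j UNIV NX NY f"
    using Pn by (simp add: multilin_scale_entries[OF f len] vector_norm_scaleR[OF NY])
  then have "(\<Prod>v\<leftarrow>vs. 1 / NX v) * NY (f vs) * (\<Prod>v\<leftarrow>vs. NX v)
      \<le> multilin_norm j UNIV NX NY f * (\<Prod>v\<leftarrow>vs. NX v)"
    by (intro mult_right_mono prod_list_vector_norm_nonneg[OF NX])
  then show ?thesis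
    using P by (simp add: ac_simps)
qed

lemma multilin_norm_le:
  assumes "0 \<in> X" "NX 0 \<le> 1"
    and "\<And>vs. vs \<in> args j X \<Longrightarrow> (\<And>v. v \<in> set vs \<Longrightarrow> NX v \<le> 1) \<Longrightarrow> NY (f vs) \<le> B"
  shows "multilin_norm j X NX NY f \<le> B"
  unfolding multilin_norm_def
proof (rule cSUP_least)
  have "replicate j 0 \<in> {vs \<in> args j X. \<forall>v\<in>set vs. NX v \<le> 1}"
    using assms(1,2) by (auto simp: args_def)
  then show "{vs \<in> args j X. \<forall>v\<in>set vs. NX v \<le> 1} \<noteq> {}"
    by blast
qed (use assms(3) in auto)

lemma multilin_space_diff:
  assumes NY: "vector_norm NY"
    and f: "f \<in> multilin_space j UNIV NX UNIV NY" and g: "g \<in> multilin_space j UNIV NX UNIV NY"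
  shows "f - g \<in> multilin_space j UNIV NX UNIV NY"
proof -
  obtain C D where C: "\<And>vs. vs \<in> args j UNIV \<Longrightarrow> NY (f vs) \<le> C * (\<Prod>v\<leftarrow>vs. NX v)"
    and D: "\<And>vs. vs \<in> args j UNIV \<Longrightarrow> NY (g vs) \<le> D * (\<Prod>v\<leftarrow>vs. NX v)"
    using multilin_bounded[OF f] multilin_bounded[OF g] by metis
  have "NY ((f - g) vs) \<le> (C + D) * (\<Prod>v\<leftarrow>vs. NX v)" if "vs \<in> args j UNIV" for vs
    using vector_norm_diff_le[OF NY, of "f vs" "g vs"] C[OF that] D[OF that]
    by (simp add: distrib_right)
  then have "\<exists>C. \<forall>vs\<in>args j UNIV. NY ((f - g) vs) \<le> C * (\<Prod>v\<leftarrow>vs. NX v)"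
    by blast
  then show ?thesis
    unfolding multilin_space_def mem_Collect_eq
    by (intro conjI) (auto simp: args_def multilin_update[OF f] multilin_update[OF g] algebra_simps)
qed

text \<open>
  A \<open>(j+1)\<close>-linear map with its first argument fixed is \<open>j\<close>-linear. In this way the values of
  \<open>Dg (Suc j)\<close> become linear approximations of increments of \<open>Dg j\<close>.
\<close>

lemma multilin_space_slice:
  assumes f: "f \<in> multilin_space (Suc j) UNIV NX UNIV NY"
  shows "(\<lambda>vs. f (h # vs)) \<in> multilin_space j UNIV NX UNIV NY"
proof -
  obtain C where C: "\<And>vs. vs \<in> args (Suc j) UNIV \<Longrightarrow> NY (f vs) \<le> C * (\<Prod>v\<leftarrow>vs. NX v)"
    using multilin_bounded[OF f] by blast
  have "NY (f (h # vs)) \<le> (C * NX h) * (\<Prod>v\<leftarrow>vs. NX v)" if "vs \<in> args j UNIV" for vs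
    using C[of "h # vs"] that by (simp add: args_def mult.assoc)
  then have "\<exists>C. \<forall>vs\<in>args j UNIV. NY (f (h # vs)) \<le> C * (\<Prod>v\<leftarrow>vs. NX v)"
    by blast
  moreover have "f (h # vs[i := r *\<^sub>R a + s *\<^sub>R b])
      = r *\<^sub>R f (h # vs[i := a]) + s *\<^sub>R f (h # vs[i := b])"
    if "length vs = j" "i < j" for vs i r s a b
    using multilin_update[OF f, of "h # vs" "Suc i"] that by simp
  ultimately show ?thesis
    unfolding multilin_space_def by (auto simp: args_def)
qed

lemma linear_multilin_head:
  assumes f: "f \<in> multilin_space (Suc j) UNIV NX UNIV NY" and "length vs = j"
  shows "linear (\<lambda>v. f (v # vs))"
proof (rule linearI)
  fix a b r
  have *: "f ((r *\<^sub>R a + s *\<^sub>R b) # vs) = r *\<^sub>R f (a # vs) + s *\<^sub>R f (b # vs)" for a b r s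
    using multilin_update[OF f, of "a # vs" 0 r a s b] assms(2) by simp
  show "f ((a + b) # vs) = f (a # vs) + f (b # vs)"
    using *[of 1 a 1 b] by simp
  show "f ((r *\<^sub>R a) # vs) = r *\<^sub>R f (a # vs)"
    using *[of r a 0 a] by simp
qed

text \<open>
  In finite dimension a multilinear map is continuous: expanding the first argument in the
  standard basis reduces the number of arguments by one.
\<close>

lemma continuous_on_multilin:
  fixes f :: "'x::euclidean_space list \<Rightarrow> 'y::real_normed_vector"
  assumes "f \<in> multilin_space (length vs) UNIV NX UNIV NY"
    and "\<And>v. v \<in> set vs \<Longrightarrow> continuous_on S v"
  shows "continuous_on S (\<lambda>y. f (map (\<lambda>v. v y) vs))"
  using assms
proof (induction vs arbitrary: f)
  case (Cons v vs)
  have "f (map (\<lambda>v. v y) (v # vs)) = (\<Sum>b\<in>Basis. (v y \<bullet> b) *\<^sub>R f (b # map (\<lambda>v. v y) vs))" for y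
  proof -
    have "linear (\<lambda>a. f (a # map (\<lambda>v. v y) vs))"
      by (rule linear_multilin_head) (use Cons.prems(1) in auto)
    from linear_sum[OF this, of "\<lambda>b. (v y \<bullet> b) *\<^sub>R b" Basis] linear_scale[OF this]
    show ?thesis
      by (simp add: euclidean_representation)
  qed
  moreover have "continuous_on S (\<lambda>y. f (b # map (\<lambda>v. v y) vs))" for b
    by (rule Cons.IH) (use Cons.prems in \<open>auto intro: multilin_space_slice\<close>)
  ultimately show ?case
    using Cons.prems(2) by (auto intro!: continuous_intros)
qed simp

section \<open>Hoelder spaces\<close>

lemma holder_space_sup:
  assumes u: "u \<in> holder_space \<alpha> N"
  shows "N (u x) \<le> holder_norm \<alpha> N u"
proof -
  have "ennreal (N (u x)) \<le> sup_norm N u"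
    unfolding sup_norm_def by (rule SUP_upper) simp
  also have "\<dots> \<le> holder_enorm \<alpha> N u"
    by (simp add: holder_enorm_def)
  also have "\<dots> = ennreal (holder_norm \<alpha> N u)"
    using u by (simp add: holder_norm_def holder_space_def)
  finally show ?thesis
    by (simp add: ennreal_le_iff holder_norm_def)
qed

lemma holder_space_seminorm:
  assumes u: "u \<in> holder_space \<alpha> N" and "\<alpha> \<noteq> 0" "x \<noteq> y"
  shows "N (u x - u y) \<le> holder_norm \<alpha> N u * dist x y powr \<alpha>"
proof -
  have "ennreal (N (u x - u y) / dist x y powr \<alpha>) \<le> holder_seminorm \<alpha> N u"
    unfolding holder_seminorm_def using assms(3) by (intro SUP_upper2[of "(x, y)"]) auto
  also have "\<dots> \<le> holder_enorm \<alpha> N u"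
    using assms(2) by (simp add: holder_enorm_def)
  also have "\<dots> = ennreal (holder_norm \<alpha> N u)"
    using u by (simp add: holder_norm_def holder_space_def)
  finally have "N (u x - u y) / dist x y powr \<alpha> \<le> holder_norm \<alpha> N u"
    by (simp add: ennreal_le_iff holder_norm_def)
  then show ?thesis
    using assms(3) by (simp add: pos_divide_le_eq)
qed

lemma holder_space_continuous:
  fixes u :: "'a::metric_space \<Rightarrow> 'v::euclidean_space"
  assumes N: "vector_norm N" and "0 \<le> \<alpha>" and u: "u \<in> holder_space \<alpha> N"
  shows "continuous_on UNIV u"
proof (cases "\<alpha> = 0")
  case False
  obtain C where C: "C > 0" "\<And>x. norm x \<le> C * N x"
    using vector_norm_equivalent[OF N] by metis
  define H where "H = C * holder_norm \<alpha> N u"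
  have "norm (u y - u x) \<le> H * dist y x powr \<alpha>" for x y
  proof (cases "y = x")
    case False
    have "norm (u y - u x) \<le> C * N (u y - u x)"
      by (rule C)
    also have "\<dots> \<le> C * (holder_norm \<alpha> N u * dist y x powr \<alpha>)"
      using C(1) holder_space_seminorm[OF u \<open>\<alpha> \<noteq> 0\<close> False] by (intro mult_left_mono) auto
    finally show ?thesis by (simp add: H_def mult.assoc)
  qed simp
  moreover have "((\<lambda>y. dist y x powr \<alpha>) \<longlongrightarrow> 0) (at x)" for x :: 'a
    using False \<open>0 \<le> \<alpha>\<close> iffD1[OF tendsto_dist_iff tendsto_ident_at[of x UNIV]]
    by (intro tendsto_zero_powrI[of _ _ _ \<alpha>]) auto
  then have "((\<lambda>y. H * dist y x powr \<alpha>) \<longlongrightarrow> 0) (at x)" for x :: 'a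
    by (rule tendsto_mult_right_zero)
  ultimately have "((\<lambda>y. u y - u x) \<longlongrightarrow> 0) (at x)" for x
    using Lim_null_comparison[of "\<lambda>y. u y - u x" "\<lambda>y. H * dist y x powr \<alpha>"] by simp
  then show ?thesis
    unfolding continuous_on_def using LIM_zero_cancel by blast
qed (use u in \<open>simp add: holder_space_def\<close>)

lemma holder_spaceI:
  assumes "\<alpha> \<noteq> 0" "0 \<le> B" "\<And>x. N (u x) \<le> B" "\<And>x y. N (u x - u y) \<le> B * dist x y powr \<alpha>"
  shows "u \<in> holder_space \<alpha> N" "holder_norm \<alpha> N u \<le> B"
proof -
  have "holder_seminorm \<alpha> N u \<le> ennreal B"
    unfolding holder_seminorm_def
    by (rule SUP_least) (auto intro!: ennreal_leI simp: assms pos_divide_le_eq)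
  moreover have "sup_norm N u \<le> ennreal B"
    unfolding sup_norm_def by (rule SUP_least) (intro ennreal_leI assms)
  ultimately have *: "holder_enorm \<alpha> N u \<le> ennreal B"
    using assms(1) by (simp add: holder_enorm_def)
  then show "u \<in> holder_space \<alpha> N"
    using assms(1) by (auto simp: holder_space_def intro: le_less_trans)
  show "holder_norm \<alpha> N u \<le> B"
    using enn2real_mono[OF *] assms(2) by (simp add: holder_norm_def)
qed

lemma zero_in_holder_space:
  fixes N :: "'v::real_normed_vector \<Rightarrow> real"
  assumes "vector_norm N"
  shows "(0 :: 'a::metric_space \<Rightarrow> 'v) \<in> holder_space \<alpha> N"
    "holder_norm \<alpha> N (0 :: 'a \<Rightarrow> 'v) = 0"
proof -
  have "sup_norm N (0 :: 'a \<Rightarrow> 'v) = 0"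
    using assms by (simp add: sup_norm_def vector_norm_zero)
  moreover have "holder_seminorm \<alpha> N (0 :: 'a \<Rightarrow> 'v) = 0"
    using assms by (auto simp: holder_seminorm_def vector_norm_zero intro!: antisym SUP_least)
  ultimately have "holder_enorm \<alpha> N (0 :: 'a \<Rightarrow> 'v) = 0"
    by (simp add: holder_enorm_def)
  then show "(0 :: 'a \<Rightarrow> 'v) \<in> holder_space \<alpha> N" "holder_norm \<alpha> N (0 :: 'a \<Rightarrow> 'v) = 0"
    by (simp_all add: holder_space_def holder_norm_def zero_fun_def)
qed

text \<open>
  A function of infinite Hoelder norm has \<open>holder_norm\<close> equal to \<open>0\<close>, so smallness of
  \<open>holder_norm \<alpha> N (u - v)\<close> says that \<open>u\<close> and \<open>v\<close> are close only because the difference stays in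
  the space.
\<close>

lemma holder_space_diff:
  fixes u v :: "'a::metric_space \<Rightarrow> 'v::real_normed_vector"
  assumes N: "vector_norm N" and u: "u \<in> holder_space \<alpha> N" and v: "v \<in> holder_space \<alpha> N"
  shows "u - v \<in> holder_space \<alpha> N"
proof -
  let ?B = "holder_norm \<alpha> N u + holder_norm \<alpha> N v"
  have sup: "N ((u - v) x) \<le> ?B" for x
    using vector_norm_diff_le[OF N, of "u x" "v x"] holder_space_sup[OF u, of x]
      holder_space_sup[OF v, of x] by simp
  show ?thesis
  proof (cases "\<alpha> = 0")
    case True
    have "continuous_on UNIV (u - v)"
      using u v True by (auto simp: holder_space_def fun_diff_def intro!: continuous_on_diff)
    moreover have "sup_norm N (u - v) \<le> ennreal ?B"
      unfolding sup_norm_def by (rule SUP_least) (intro ennreal_leI sup)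
    ultimately show ?thesis
      using True by (auto simp: holder_space_def holder_enorm_def intro: le_less_trans)
  next
    case False
    have "N ((u - v) x - (u - v) y) \<le> ?B * dist x y powr \<alpha>" for x y
    proof (cases "x = y")
      case True
      then show ?thesis by (simp add: vector_norm_zero[OF N])
    next
      case False
      have "(u - v) x - (u - v) y = (u x - u y) - (v x - v y)"
        by simp
      then have "N ((u - v) x - (u - v) y) = N ((u x - u y) - (v x - v y))"
        by (rule arg_cong)
      then show ?thesis
        unfolding distrib_right
        using vector_norm_diff_le[OF N, of "u x - u y" "v x - v y"]
          holder_space_seminorm[OF u \<open>\<alpha> \<noteq> 0\<close> False] holder_space_seminorm[OF v \<open>\<alpha> \<noteq> 0\<close> False]
        by linarith
    qed
    moreover have "0 \<le> ?B"
      by (simp add: holder_norm_def)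
    ultimately show ?thesis
      using holder_spaceI(1)[of \<alpha> ?B N "u - v"] False sup by blast
  qed
qed

section \<open>The Fredholm operator\<close>

text \<open>
  The kernel enters only through the \<open>L\<^sup>1\<close> bounds of the sections \<open>k x\<close> and of their differences.
  Both are stated in Euclidean norms, so that the given norms only change the constant \<open>K\<close>.
\<close>

locale fredholm_kernel =
  fixes M :: "'a::metric_space measure" and k :: "'b::metric_space \<Rightarrow> 'a \<Rightarrow> real^'p^'d"
    and K \<beta> :: real
  assumes compact_domain: "compact (UNIV :: 'a set)"
    and space_M: "space M = UNIV"
    and borel_sets: "sets borel \<subseteq> sets M"
    and kernel_measurable: "\<And>x. k x \<in> borel_measurable M"
    and K_nonneg: "0 \<le> K"
    and beta_nonzero: "\<beta> \<noteq> 0"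
    and kernel_bound: "\<And>x. (\<integral>\<^sup>+y. norm (k x y) \<partial>M) \<le> ennreal K"
    and kernel_holder: "\<And>x x'. (\<integral>\<^sup>+y. norm (k x y - k x' y) \<partial>M) \<le> ennreal (K * dist x x' powr \<beta>)"
begin

lemma continuous_measurable:
  fixes w :: "'a \<Rightarrow> 'v::{real_normed_vector, second_countable_topology}"
  assumes "continuous_on UNIV w"
  shows "w \<in> borel_measurable M"
proof -
  have "w \<in> borel_measurable borel"
    using assms by (rule borel_measurable_continuous_onI)
  then show ?thesis
    using borel_sets space_M
    by (auto simp: measurable_def)
qed

lemma continuous_bounded:
  fixes w :: "'a \<Rightarrow> 'v::real_normed_vector"
  assumes "continuous_on UNIV w"
  obtains B where "\<And>y. norm (w y) \<le> B"
  using compact_imp_bounded[OF compact_continuous_image[OF assms compact_domain]]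
  unfolding bounded_iff by blast

lemma integral_mult_vector_bound:
  fixes A :: "'a \<Rightarrow> real^'p^'d" and w :: "'a \<Rightarrow> real^'p"
  assumes A: "A \<in> borel_measurable M" "(\<integral>\<^sup>+y. norm (A y) \<partial>M) \<le> ennreal I" "0 \<le> I"
    and w: "w \<in> borel_measurable M" "\<And>y. norm (w y) \<le> B"
    and mult: "0 \<le> c" "\<And>(A :: real^'p^'d) w. norm (A *v w) \<le> c * norm A * norm w"
  shows "integrable M (\<lambda>y. A y *v w y)" "norm (\<integral>y. A y *v w y \<partial>M) \<le> c * B * I"
proof -
  have "0 \<le> B"
    using norm_ge_zero order_trans w(2) by blast
  have "continuous_on UNIV (\<lambda>q :: (real^'p^'d) \<times> (real^'p). fst q *v snd q)"
    unfolding matrix_vector_mult_def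
    by (intro continuous_on_vec_lambda continuous_intros)
  from borel_measurable_continuous_Pair[OF A(1) w(1) this]
  have meas: "(\<lambda>y. A y *v w y) \<in> borel_measurable M"
    by simp
  have "(\<integral>\<^sup>+y. norm (A y *v w y) \<partial>M) \<le> (\<integral>\<^sup>+y. ennreal (c * B) * norm (A y) \<partial>M)"
  proof (rule nn_integral_mono)
    fix y
    have "norm (A y *v w y) \<le> c * norm (A y) * norm (w y)"
      by (rule mult)
    also have "\<dots> \<le> c * norm (A y) * B"
      using mult(1) w(2) by (intro mult_left_mono) auto
    finally show "ennreal (norm (A y *v w y)) \<le> ennreal (c * B) * norm (A y)"
      using mult(1) \<open>0 \<le> B\<close> by (simp add: ennreal_mult[symmetric] ac_simps)
  qed
  also have "\<dots> = ennreal (c * B) * (\<integral>\<^sup>+y. norm (A y) \<partial>M)"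
    using A(1) by (intro nn_integral_cmult) measurable
  also have "\<dots> \<le> ennreal (c * B) * ennreal I"
    by (intro mult_left_mono A) simp
  also have "\<dots> = ennreal (c * B * I)"
    using mult(1) \<open>0 \<le> B\<close> A(3) by (simp add: ennreal_mult)
  finally have *: "(\<integral>\<^sup>+y. norm (A y *v w y) \<partial>M) \<le> ennreal (c * B * I)" .
  then show int: "integrable M (\<lambda>y. A y *v w y)"
    by (intro integrableI_bounded meas) (auto intro: le_less_trans)
  have "ennreal (norm (\<integral>y. A y *v w y \<partial>M)) \<le> ennreal (c * B * I)"
    using integral_norm_bound_ennreal[OF int] * by (rule order_trans)
  then show "norm (\<integral>y. A y *v w y \<partial>M) \<le> c * B * I"
    using mult(1) \<open>0 \<le> B\<close> A(3) by (simp add: ennreal_le_iff)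
qed

lemma matrix_vector_norm_bound:
  obtains c where "0 \<le> c" "\<And>(A :: real^'p^'d) w. norm (A *v w) \<le> c * norm A * norm w"
proof -
  have "bilinear ((*v) :: real^'p^'d \<Rightarrow> real^'p \<Rightarrow> real^'d)"
    unfolding bilinear_def
    by (auto intro!: linearI simp: matrix_vector_mult_add_rdistrib scaleR_matrix_vector_assoc)
  then have "bounded_bilinear ((*v) :: real^'p^'d \<Rightarrow> real^'p \<Rightarrow> real^'d)"
    by (simp add: bilinear_conv_bounded_bilinear)
  from bounded_bilinear.nonneg_bounded[OF this] show ?thesis
    using that by (auto simp: ac_simps)
qed

lemma kernel_integrable:
  assumes w: "continuous_on UNIV w"
  shows "integrable M (\<lambda>y. k x y *v w y)"
proof -
  obtain B where "\<And>y. norm (w y) \<le> B"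
    using continuous_bounded[OF w] by blast
  moreover obtain c where "0 \<le> c" "\<And>(A :: real^'p^'d) w. norm (A *v w) \<le> c * norm A * norm w"
    using matrix_vector_norm_bound by blast
  ultimately show ?thesis
    using kernel_measurable kernel_bound K_nonneg continuous_measurable[OF w]
    by (intro integral_mult_vector_bound(1)[of _ K _ B c])
qed

lemma fredholm_linear:
  assumes "continuous_on UNIV v" "continuous_on UNIV w"
  shows "fredholm M k (\<lambda>y. r *\<^sub>R v y + s *\<^sub>R w y) = r *\<^sub>R fredholm M k v + s *\<^sub>R fredholm M k w"
  by (rule ext) (simp add: fredholm_def scaleR_fun_def matrix_vector_right_distrib
      matrix_vector_mult_scaleR kernel_integrable[OF assms(1)] kernel_integrable[OF assms(2)])

lemma fredholm_diff:
  assumes "continuous_on UNIV v" "continuous_on UNIV w"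
  shows "fredholm M k v - fredholm M k w = fredholm M k (\<lambda>y. v y - w y)"
  by (rule ext) (simp add: fredholm_def matrix_vector_mult_diff_distrib
      kernel_integrable[OF assms(1)] kernel_integrable[OF assms(2)])

text \<open>
  The Fredholm operator is smoothing: it maps into the Hoelder space of exponent \<open>\<beta>\<close>, and its
  norm there is controlled by the sup norm alone, so that the substitution operators only need to
  be estimated in the sup norm.
\<close>

lemma fredholm_holder_bound:
  assumes Nd: "vector_norm Nd"
  obtains C where "C > 0"
    "\<And>w B. continuous_on UNIV w \<Longrightarrow> (\<And>y. norm (w y) \<le> B) \<Longrightarrow> fredholm M k w \<in> holder_space \<beta> Nd"
    "\<And>w B. continuous_on UNIV w \<Longrightarrow> (\<And>y. norm (w y) \<le> B) \<Longrightarrow>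
      holder_norm \<beta> Nd (fredholm M k w) \<le> C * B"
proof -
  obtain D where D: "D > 0" "\<And>z. Nd z \<le> D * norm z"
    using vector_norm_equivalent[OF Nd] by metis
  obtain c where c: "0 \<le> c" "\<And>(A :: real^'p^'d) w. norm (A *v w) \<le> c * norm A * norm w"
    using matrix_vector_norm_bound by blast
  \<comment> \<open>The summand 1 makes \<open>C\<close> positive, so that it can be divided by.\<close>
  define C where "C = D * c * K + 1"
  have "D * c * K \<ge> 0"
    using D c K_nonneg by simp
  then have "C > 0"
    by (simp add: C_def)
  have *: "fredholm M k w \<in> holder_space \<beta> Nd \<and> holder_norm \<beta> Nd (fredholm M k w) \<le> C * B"
    if w: "continuous_on UNIV w" "\<And>y. norm (w y) \<le> B" for w B
  proof -
    have "0 \<le> B"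
      using norm_ge_zero order_trans w(2) by blast
    note bound = integral_mult_vector_bound(2)[OF _ _ _ continuous_measurable[OF w(1)] w(2) c]
    have 1: "Nd (fredholm M k w x) \<le> C * B" for x
    proof -
      have "Nd (fredholm M k w x) \<le> D * norm (fredholm M k w x)"
        by (rule D)
      also have "\<dots> \<le> D * (c * B * K)"
        unfolding fredholm_def using D(1)
        by (intro mult_left_mono bound kernel_measurable kernel_bound K_nonneg) simp
      also have "\<dots> \<le> C * B"
        using \<open>0 \<le> B\<close> by (simp add: C_def algebra_simps)
      finally show ?thesis .
    qed
    have 2: "Nd (fredholm M k w x - fredholm M k w x') \<le> C * B * dist x x' powr \<beta>" for x x'
    proof -
      have eq: "fredholm M k w x - fredholm M k w x' = (\<integral>y. (k x y - k x' y) *v w y \<partial>M)"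
        by (simp add: fredholm_def matrix_vector_mult_diff_rdistrib kernel_integrable[OF w(1)])
      have "Nd (fredholm M k w x - fredholm M k w x') \<le> D * norm (\<integral>y. (k x y - k x' y) *v w y \<partial>M)"
        unfolding eq by (rule D)
      also have "\<dots> \<le> D * (c * B * (K * dist x x' powr \<beta>))"
        using D(1) K_nonneg
        by (intro mult_left_mono bound kernel_holder borel_measurable_diff kernel_measurable) simp_all
      also have "\<dots> \<le> C * B * dist x x' powr \<beta>"
        using \<open>0 \<le> B\<close> by (simp add: C_def algebra_simps)
      finally show ?thesis .
    qed
    have "0 \<le> C * B"
      using \<open>0 \<le> B\<close> \<open>C > 0\<close> by simp
    from holder_spaceI[OF beta_nonzero this 1 2] show ?thesis
      by blast
  qed
  show ?thesis
    by (rule that[OF \<open>C > 0\<close> conjunct1[OF *] conjunct2[OF *]])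
qed

end

section \<open>Substitution operators\<close>

lemma prod_list_mono_nonneg:
  fixes a b :: "'v \<Rightarrow> real"
  assumes "\<And>v. v \<in> set vs \<Longrightarrow> 0 \<le> a v" "\<And>v. v \<in> set vs \<Longrightarrow> a v \<le> b v"
  shows "(\<Prod>v\<leftarrow>vs. a v) \<le> (\<Prod>v\<leftarrow>vs. b v)"
proof -
  have "0 \<le> (\<Prod>v\<leftarrow>vs. a v) \<and> (\<Prod>v\<leftarrow>vs. a v) \<le> (\<Prod>v\<leftarrow>vs. b v)"
    using assms by (induction vs) (auto intro!: mult_mono intro: order_trans)
  then show ?thesis ..
qed

text \<open>
  Convergence in the operator norm, spelled out on arguments: the bound is uniform in \<open>vs\<close> up to
  the product of the norms. The limit in \<open>continuously_extends\<close> omits the point \<open>(y0, z0)\<close> itself,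
  where the bound is trivial.
\<close>

lemma continuously_extends_near:
  fixes f :: "'a::metric_space \<Rightarrow> 'n::euclidean_space \<Rightarrow> 'n list \<Rightarrow> 'p::euclidean_space"
  assumes Nn: "vector_norm Nn" and Np: "vector_norm Np"
    and f: "continuously_extends j Nn Np Z f" and z0: "z0 \<in> Z" and "e > 0"
  obtains d where "d > 0"
    "\<And>y z vs. z \<in> Z \<Longrightarrow> dist (y, z) (y0, z0) < d \<Longrightarrow> length vs = j \<Longrightarrow>
      norm (f y z vs - f y0 z0 vs) \<le> e * (\<Prod>v\<leftarrow>vs. Nn v)"
proof -
  obtain C where C: "C > 0" "\<And>x. norm x \<le> C * Np x"
    using vector_norm_equivalent[OF Np] by metis
  obtain E where E: "\<And>y z. z \<in> Z \<Longrightarrow> E y z = f y z"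
    and E_multilin: "\<And>y z. z \<in> closure Z \<Longrightarrow> E y z \<in> multilin_space j UNIV Nn UNIV Np"
    and E_lim: "\<And>y0 z0. z0 \<in> closure Z \<Longrightarrow>
      ((\<lambda>(y, z). multilin_norm j UNIV Nn Np (E y z - E y0 z0)) \<longlongrightarrow> 0)
        (at (y0, z0) within UNIV \<times> closure Z)"
    using f unfolding continuously_extends_def by blast
  have cl: "z \<in> closure Z" if "z \<in> Z" for z
    using that closure_subset by blast
  have "e / C > 0"
    using \<open>e > 0\<close> C(1) by simp
  from tendstoD[OF E_lim[OF cl[OF z0]] this, of y0]
  obtain d where d: "d > 0" "\<And>y z. z \<in> closure Z \<Longrightarrow> (y, z) \<noteq> (y0, z0) \<Longrightarrow>
      dist (y, z) (y0, z0) < d \<Longrightarrow> \<bar>multilin_norm j UNIV Nn Np (E y z - E y0 z0)\<bar> < e / C"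
    unfolding eventually_at by auto
  show ?thesis
  proof
    show "d > 0" by (rule d)
  next
    fix y z and vs :: "'n list"
    assume z: "z \<in> Z" and dist: "dist (y, z) (y0, z0) < d" and len: "length vs = j"
    show "norm (f y z vs - f y0 z0 vs) \<le> e * (\<Prod>v\<leftarrow>vs. Nn v)"
    proof (cases "(y, z) = (y0, z0)")
      case True
      then show ?thesis
        using \<open>e > 0\<close> prod_list_vector_norm_nonneg[OF Nn] by simp
    next
      case False
      have "norm (f y z vs - f y0 z0 vs) \<le> C * Np ((E y z - E y0 z0) vs)"
        using C(2) by (simp add: E z z0)
      also have "\<dots> \<le> C * (multilin_norm j UNIV Nn Np (E y z - E y0 z0) * (\<Prod>v\<leftarrow>vs. Nn v))"
        using C(1) z z0 len
        by (intro mult_left_mono multilin_norm_bound[OF Nn Np] multilin_space_diff[OF Np]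
            E_multilin cl) auto
      also have "\<dots> \<le> C * (e / C * (\<Prod>v\<leftarrow>vs. Nn v))"
        using C(1) d(2)[OF cl[OF z] False dist]
        by (intro mult_left_mono mult_right_mono prod_list_vector_norm_nonneg[OF Nn]) auto
      finally show ?thesis
        using C(1) by simp
    qed
  qed
qed

text \<open>
  Near \<open>y0\<close> the derivative may be replaced by its value at \<open>(y0, u y0)\<close>, with an error controlled by
  the locally bounded product \<open>\<Prod>v\<leftarrow>vs. Nn (v y)\<close>; what remains is a fixed multilinear map applied to
  continuous arguments.
\<close>

lemma nemytskii_continuous:
  fixes Dg :: "nat \<Rightarrow> 'a::metric_space \<Rightarrow> 'n::euclidean_space \<Rightarrow> 'n list \<Rightarrow> 'p::euclidean_space"
  assumes Nn: "vector_norm Nn" and Np: "vector_norm Np"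
    and ext: "continuously_extends j Nn Np Z (Dg j)"
    and multilin: "\<And>y z. z \<in> Z \<Longrightarrow> Dg j y z \<in> multilin_space j UNIV Nn UNIV Np"
    and u: "continuous_on UNIV u" "\<And>y. u y \<in> Z"
    and vs: "length vs = j" "\<And>v. v \<in> set vs \<Longrightarrow> continuous_on UNIV v"
  shows "continuous_on UNIV (nemytskii Dg j u vs)"
  unfolding continuous_on_def
proof
  fix y0
  let ?at = "\<lambda>y. map (\<lambda>v. v y) vs"
  let ?P = "\<lambda>y. \<Prod>v\<leftarrow>?at y. Nn v"
  have P_cont: "continuous_on UNIV ?P"
    using vs(2)
    by (induction vs)
      (auto intro!: continuous_intros continuous_on_compose2[OF continuous_on_vector_norm[OF Nn]])
  have P_nonneg: "0 \<le> ?P y" for y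
    by (rule prod_list_vector_norm_nonneg[OF Nn])
  have frozen: "continuous_on UNIV (\<lambda>y. Dg j y0 (u y0) (?at y))"
    by (rule continuous_on_multilin) (use vs multilin[OF u(2)] in auto)
  show "(nemytskii Dg j u vs \<longlongrightarrow> nemytskii Dg j u vs y0) (at y0 within UNIV)"
  proof (rule tendstoI)
    fix \<epsilon> :: real assume "\<epsilon> > 0"
    define e where "e = \<epsilon> / 2 / (?P y0 + 1)"
    have "e > 0"
      using \<open>\<epsilon> > 0\<close> P_nonneg[of y0] by (simp add: e_def add_nonneg_pos)
    then obtain d where d: "d > 0"
      "\<And>y z vs. z \<in> Z \<Longrightarrow> dist (y, z) (y0, u y0) < d \<Longrightarrow> length vs = j \<Longrightarrow>
        norm (Dg j y z vs - Dg j y0 (u y0) vs) \<le> e * (\<Prod>v\<leftarrow>vs. Nn v)"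
      using continuously_extends_near[OF Nn Np ext u(2)] by metis
    have "\<forall>\<^sub>F y in at y0. ?P y < ?P y0 + 1"
      by (rule order_tendstoD(2)[OF P_cont[unfolded continuous_on_def, rule_format]]) auto
    moreover have "((\<lambda>y. (y, u y)) \<longlongrightarrow> (y0, u y0)) (at y0)"
      using u(1) by (intro tendsto_intros) (auto simp: continuous_on_def)
    then have "\<forall>\<^sub>F y in at y0. dist (y, u y) (y0, u y0) < d"
      by (rule tendstoD) (rule d)
    moreover have "\<forall>\<^sub>F y in at y0. dist (Dg j y0 (u y0) (?at y)) (Dg j y0 (u y0) (?at y0)) < \<epsilon> / 2"
      by (rule tendstoD[OF frozen[unfolded continuous_on_def, rule_format]])
        (use \<open>\<epsilon> > 0\<close> in auto)
    ultimately show "\<forall>\<^sub>F y in at y0. dist (nemytskii Dg j u vs y) (nemytskii Dg j u vs y0) < \<epsilon>"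
    proof eventually_elim
      case (elim y)
      have "norm (Dg j y (u y) (?at y) - Dg j y0 (u y0) (?at y)) \<le> e * ?P y"
        using d(2)[OF u(2) elim(2), of "?at y"] vs(1) by simp
      also have "\<dots> \<le> e * (?P y0 + 1)"
        using elim(1) \<open>e > 0\<close> by (intro mult_left_mono) auto
      also have "\<dots> = \<epsilon> / 2"
      proof -
        have "?P y0 + 1 \<noteq> 0"
          using P_nonneg[of y0] by linarith
        from iffD1[OF nonzero_eq_divide_eq[OF this] e_def] show ?thesis .
      qed
      finally have "dist (Dg j y (u y) (?at y)) (Dg j y0 (u y0) (?at y)) \<le> \<epsilon> / 2"
        by (simp add: dist_norm)
      with elim(3) show ?case
        using dist_triangle[of "Dg j y (u y) (?at y)" "Dg j y0 (u y0) (?at y0)"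
            "Dg j y0 (u y0) (?at y)"]
        by (simp add: nemytskii_def)
    qed
  qed
qed

text \<open>
  The graph of \<open>u\<close> is compact, so the Lebesgue number lemma makes the continuity of the derivative
  uniform along it. Uniform continuity on all of \<open>\<Omega> \<times> Z\<close> is not available, since \<open>Z\<close> may be
  unbounded.
\<close>

lemma uniform_near_graph:
  fixes f :: "'a::metric_space \<Rightarrow> 'n::euclidean_space \<Rightarrow> 'n list \<Rightarrow> 'p::euclidean_space"
  assumes Nn: "vector_norm Nn" and Np: "vector_norm Np"
    and f: "continuously_extends j Nn Np Z f"
    and compact: "compact (UNIV :: 'a set)" and u: "continuous_on UNIV u" "\<And>y. u y \<in> Z"
    and "e > 0"
  obtains d where "d > 0"
    "\<And>y z vs. z \<in> Z \<Longrightarrow> Nn (z - u y) < d \<Longrightarrow> length vs = j \<Longrightarrow>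
      norm (f y z vs - f y (u y) vs) \<le> e * (\<Prod>v\<leftarrow>vs. Nn v)"
proof -
  obtain C where C: "C > 0" "\<And>x. norm x \<le> C * Nn x"
    using vector_norm_equivalent[OF Nn] by metis
  have "\<exists>r>0. \<forall>y z vs. z \<in> Z \<longrightarrow> dist (y, z) (y0, u y0) < r \<longrightarrow> length vs = j \<longrightarrow>
      norm (f y z vs - f y0 (u y0) vs) \<le> e / 2 * (\<Prod>v\<leftarrow>vs. Nn v)" for y0
    using continuously_extends_near[OF Nn Np f u(2), of "e / 2"] \<open>e > 0\<close> by (metis half_gt_zero)
  then obtain r where r: "\<And>y0. r y0 > 0"
    "\<And>y0 y z vs. z \<in> Z \<Longrightarrow> dist (y, z) (y0, u y0) < r y0 \<Longrightarrow> length vs = j \<Longrightarrow>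
      norm (f y z vs - f y0 (u y0) vs) \<le> e / 2 * (\<Prod>v\<leftarrow>vs. Nn v)"
    by metis
  have "compact (range (\<lambda>y. (y, u y)))"
    by (intro compact_continuous_image compact continuous_intros u)
  moreover have "range (\<lambda>y. (y, u y)) \<subseteq> \<Union> (range (\<lambda>y0. ball (y0, u y0) (r y0)))"
  proof -
    have "(y, u y) \<in> ball (y, u y) (r y)" for y
      using r(1) by simp
    then show ?thesis
      by blast
  qed
  ultimately obtain d where "d > 0" and
    lebesgue: "\<And>q. q \<in> range (\<lambda>y. (y, u y)) \<Longrightarrow> \<exists>G\<in>range (\<lambda>y0. ball (y0, u y0) (r y0)). ball q d \<subseteq> G"
    by (rule Heine_Borel_lemma) auto
  show ?thesis
  proof
    show "d / C > 0"
      using \<open>d > 0\<close> C(1) by simp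
  next
    fix y z and vs :: "'n list"
    assume z: "z \<in> Z" "Nn (z - u y) < d / C" and len: "length vs = j"
    have "norm (z - u y) < d"
      using C(2)[of "z - u y"] z(2) C(1) by (simp add: pos_less_divide_eq mult.commute)
    then have "(y, z) \<in> ball (y, u y) d" "(y, u y) \<in> ball (y, u y) d"
      using \<open>d > 0\<close> by (auto simp: dist_Pair_Pair dist_norm norm_minus_commute)
    with lebesgue obtain y0 where "(y, z) \<in> ball (y0, u y0) (r y0)" "(y, u y) \<in> ball (y0, u y0) (r y0)"
      by blast
    then have "dist (y, z) (y0, u y0) < r y0" "dist (y, u y) (y0, u y0) < r y0"
      by (simp_all only: mem_ball dist_commute)
    from r(2)[OF z(1) this(1) len] r(2)[OF u(2) this(2) len]
    show "norm (f y z vs - f y (u y) vs) \<le> e * (\<Prod>v\<leftarrow>vs. Nn v)"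
      using norm_triangle_ineq4[of "f y z vs - f y0 (u y0) vs" "f y (u y) vs - f y0 (u y0) vs"]
      by (simp add: field_simps)
  qed
qed

text \<open>
  Each point of \<open>\<Omega>\<close> has a neighbourhood with a common bound, and finitely many of these cover \<open>\<Omega>\<close>.
\<close>

lemma bounded_on_graph:
  fixes f :: "'a::metric_space \<Rightarrow> 'n::euclidean_space \<Rightarrow> 'n list \<Rightarrow> 'p::euclidean_space"
  assumes Nn: "vector_norm Nn" and Np: "vector_norm Np"
    and f: "continuously_extends j Nn Np Z f"
    and multilin: "\<And>y z. z \<in> Z \<Longrightarrow> f y z \<in> multilin_space j UNIV Nn UNIV Np"
    and compact: "compact (UNIV :: 'a set)" and u: "continuous_on UNIV u" "\<And>y. u y \<in> Z"
  obtains B where "\<And>y vs. length vs = j \<Longrightarrow> norm (f y (u y) vs) \<le> B * (\<Prod>v\<leftarrow>vs. Nn v)"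
proof -
  obtain C where C: "C > 0" "\<And>x. norm x \<le> C * Np x"
    using vector_norm_equivalent[OF Np] by metis
  define bound where "bound B y \<longleftrightarrow>
      (\<forall>vs. length vs = j \<longrightarrow> norm (f y (u y) vs) \<le> B * (\<Prod>v\<leftarrow>vs. Nn v))" for B y
  have "\<exists>T B. open T \<and> y0 \<in> T \<and> (\<forall>y\<in>T. bound B y)" for y0
  proof -
    obtain d where d: "d > 0"
      "\<And>y z vs. z \<in> Z \<Longrightarrow> dist (y, z) (y0, u y0) < d \<Longrightarrow> length vs = j \<Longrightarrow>
        norm (f y z vs - f y0 (u y0) vs) \<le> 1 * (\<Prod>v\<leftarrow>vs. Nn v)"
      using continuously_extends_near[OF Nn Np f u(2) zero_less_one] by metis
    let ?T = "{y. dist (y, u y) (y0, u y0) < d}"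
    let ?B = "1 + C * multilin_norm j UNIV Nn Np (f y0 (u y0))"
    have "norm (f y (u y) vs) \<le> ?B * (\<Prod>v\<leftarrow>vs. Nn v)" if "y \<in> ?T" "length vs = j" for y vs
    proof -
      have "norm (f y0 (u y0) vs) \<le> C * Np (f y0 (u y0) vs)"
        by (rule C)
      also have "\<dots> \<le> C * (multilin_norm j UNIV Nn Np (f y0 (u y0)) * (\<Prod>v\<leftarrow>vs. Nn v))"
        using C(1) that(2) by (intro mult_left_mono multilin_norm_bound[OF Nn Np] multilin u) auto
      finally have "norm (f y0 (u y0) vs)
          \<le> C * multilin_norm j UNIV Nn Np (f y0 (u y0)) * (\<Prod>v\<leftarrow>vs. Nn v)"
        by (simp only: mult.assoc)
      moreover have "norm (f y (u y) vs - f y0 (u y0) vs) \<le> 1 * (\<Prod>v\<leftarrow>vs. Nn v)"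
        by (rule d(2)[OF u(2)]) (use that in simp_all)
      ultimately show ?thesis
        unfolding distrib_right
        using norm_triangle_sub[of "f y (u y) vs" "f y0 (u y0) vs"] by linarith
    qed
    moreover have "open ?T"
      by (intro open_Collect_less continuous_intros u)
    ultimately show ?thesis
      using d(1) unfolding bound_def by (intro exI[of _ ?T] exI[of _ ?B]) auto
  qed
  then obtain T B where T: "\<And>y0. open (T y0)" "\<And>y0. y0 \<in> T y0"
    and B: "\<And>y0 y. y \<in> T y0 \<Longrightarrow> bound (B y0) y"
    by metis
  have "UNIV \<subseteq> (\<Union>y0\<in>UNIV. T y0)"
    using T(2) by blast
  then obtain F where F: "finite F" "UNIV \<subseteq> (\<Union>y0\<in>F. T y0)"
    by (rule compactE_image[OF compact T(1)])
  show ?thesis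
  proof
    fix y and vs :: "'n list" assume len: "length vs = j"
    obtain y0 where y0: "y0 \<in> F" "y \<in> T y0"
      using F(2) by blast
    then have "norm (f y (u y) vs) \<le> B y0 * (\<Prod>v\<leftarrow>vs. Nn v)"
      using B len unfolding bound_def by blast
    also have "\<dots> \<le> (\<Sum>y0\<in>F. \<bar>B y0\<bar>) * (\<Prod>v\<leftarrow>vs. Nn v)"
      using member_le_sum[OF y0(1), of "\<lambda>y0. \<bar>B y0\<bar>"] F(1)
      by (intro mult_right_mono prod_list_vector_norm_nonneg[OF Nn]) auto
    finally show "norm (f y (u y) vs) \<le> (\<Sum>y0\<in>F. \<bar>B y0\<bar>) * (\<Prod>v\<leftarrow>vs. Nn v)" .
  qed
qed

text \<open>
  At boundary points of \<open>Z\<close> the derivative belongs to some extension, but restricted to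
  increments that stay in \<open>Z\<close> it is a derivative of \<open>Dg j\<close> itself. This is all that segments
  in the convex set \<open>Z\<close> need.
\<close>

lemma partial_derivative_within:
  assumes "partial_derivatives Nn Np Z m g Dg" "j < m" "z \<in> Z"
  shows "frechet_within UNIV Nn Z (multilin_norm j UNIV Nn Np) (Dg j y)
    (\<lambda>h vs. Dg (Suc j) y z (h # vs)) z"
proof -
  note derivative = bspec[OF mp[OF spec[OF conjunct2[OF conjunct2[OF
    assms(1)[unfolded partial_derivatives_def]]]] assms(2)] assms(3)]
  show ?thesis
  proof (cases "z \<in> interior Z")
    case True
    from derivative[unfolded if_P[OF True]] show ?thesis
      by (rule spec)
  next
    case False
    from derivative[unfolded if_not_P[OF False]]
    obtain V G where VG: "\<forall>y. (\<forall>x\<in>Z. G y x = Dg j y x) \<and>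
        (\<forall>x\<in>Z \<union> V. G y x \<in> multilin_space j UNIV Nn UNIV Np) \<and>
        frechet_within UNIV Nn (Z \<union> V) (multilin_norm j UNIV Nn Np) (G y)
          (\<lambda>h vs. Dg (Suc j) y z (h # vs)) z"
      by (elim exE conjE)
    have G: "G y x = Dg j y x" if "x \<in> Z" for x
      using VG that by simp
    from VG have "frechet_within UNIV Nn (Z \<union> V) (multilin_norm j UNIV Nn Np) (G y)
        (\<lambda>h vs. Dg (Suc j) y z (h # vs)) z"
      by simp
    then have "frechet_within UNIV Nn Z (multilin_norm j UNIV Nn Np) (G y)
        (\<lambda>h vs. Dg (Suc j) y z (h # vs)) z"
      unfolding frechet_within_def by (meson UnI1)
    then show ?thesis
      unfolding frechet_within_def by (simp add: G assms(3) cong: conj_cong imp_cong)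
  qed
qed

text \<open>
  The derivative in the operator norm, evaluated at fixed arguments \<open>vs\<close> and restricted to a line
  in direction \<open>h\<close>. The parameter set \<open>S\<close> may have boundary points, as the line may leave \<open>Z\<close>.
\<close>

lemma partial_derivative_along_segment:
  fixes Dg :: "nat \<Rightarrow> 'a \<Rightarrow> 'n::euclidean_space \<Rightarrow> 'n list \<Rightarrow> 'p::euclidean_space"
  assumes Nn: "vector_norm Nn" and Np: "vector_norm Np"
    and pd: "partial_derivatives Nn Np Z m g Dg" "j < m"
    and len: "length vs = j" and t: "t \<in> S" and Z: "\<And>t. t \<in> S \<Longrightarrow> z + t *\<^sub>R h \<in> Z"
  shows "((\<lambda>t. Dg j y (z + t *\<^sub>R h) vs) has_vector_derivative Dg (Suc j) y (z + t *\<^sub>R h) (h # vs))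
    (at t within S)"
  unfolding has_vector_derivative_def has_derivative_within_alt
proof (intro conjI allI impI)
  show "bounded_linear (\<lambda>s. s *\<^sub>R Dg (Suc j) y (z + t *\<^sub>R h) (h # vs))"
    by (rule bounded_linear_scaleR_left)
next
  fix \<epsilon> :: real assume "\<epsilon> > 0"
  obtain C where C: "C > 0" "\<And>x. norm x \<le> C * Np x"
    using vector_norm_equivalent[OF Np] by metis
  have multilin: "Dg i y x \<in> multilin_space i UNIV Nn UNIV Np" if "i \<le> m" "x \<in> Z" for i x
    using pd(1) that by (simp add: partial_derivatives_def)
  let ?z = "z + t *\<^sub>R h" and ?P = "\<Prod>v\<leftarrow>vs. Nn v"
  have nonneg: "0 \<le> Nn h" "0 \<le> ?P"
    by (simp_all add: vector_norm_nonneg[OF Nn] prod_list_vector_norm_nonneg[OF Nn])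
  \<comment> \<open>The summand 1 keeps the denominator positive when \<open>h\<close> or an entry of \<open>vs\<close> is 0.\<close>
  define \<eta> where "\<eta> = \<epsilon> / (C * (Nn h * ?P + 1))"
  have "\<eta> > 0" "C * \<eta> * (Nn h * ?P) \<le> \<epsilon>"
  proof -
    have "C * \<eta> * (Nn h * ?P) = \<epsilon> * ((Nn h * ?P) / (Nn h * ?P + 1))"
      using C(1) by (simp add: \<eta>_def)
    also have "\<dots> \<le> \<epsilon> * 1"
      using nonneg \<open>\<epsilon> > 0\<close> by (intro mult_left_mono) (auto simp: divide_le_eq_1 add_nonneg_pos)
    finally show "C * \<eta> * (Nn h * ?P) \<le> \<epsilon>" by simp
    show "\<eta> > 0"
      using nonneg C(1) \<open>\<epsilon> > 0\<close> by (simp add: \<eta>_def add_nonneg_pos)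
  qed
  obtain \<delta> where "\<delta> > 0" and \<delta>: "\<And>k. ?z + k \<in> Z \<Longrightarrow> Nn k < \<delta> \<Longrightarrow>
      multilin_norm j UNIV Nn Np
        (Dg j y (?z + k) - Dg j y ?z - (\<lambda>vs. Dg (Suc j) y ?z (k # vs))) \<le> \<eta> * Nn k"
    using partial_derivative_within[OF pd Z[OF t], of y] \<open>\<eta> > 0\<close>
    unfolding frechet_within_def by (metis UNIV_I)
  show "\<exists>d>0. \<forall>s\<in>S. norm (s - t) < d \<longrightarrow>
      norm (Dg j y (z + s *\<^sub>R h) vs - Dg j y ?z vs - (s - t) *\<^sub>R Dg (Suc j) y ?z (h # vs))
        \<le> \<epsilon> * norm (s - t)"
  proof (intro exI[of _ "\<delta> / (Nn h + 1)"] conjI ballI impI)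
    show "0 < \<delta> / (Nn h + 1)"
      using \<open>\<delta> > 0\<close> nonneg by (simp add: add_nonneg_pos)
  next
    fix s assume s: "s \<in> S" "norm (s - t) < \<delta> / (Nn h + 1)"
    define k where "k = (s - t) *\<^sub>R h"
    have zk: "z + s *\<^sub>R h = ?z + k"
      by (simp add: k_def algebra_simps)
    have Nk: "Nn k = \<bar>s - t\<bar> * Nn h"
      by (simp add: k_def vector_norm_scaleR[OF Nn])
    have "\<bar>s - t\<bar> * (Nn h + 1) < \<delta>"
      using s(2) nonneg by (simp add: pos_less_divide_eq add_nonneg_pos)
    then have "Nn k < \<delta>"
      unfolding Nk by (simp add: distrib_left)
    let ?R = "Dg j y (?z + k) - Dg j y ?z - (\<lambda>vs. Dg (Suc j) y ?z (k # vs))"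
    have R: "multilin_norm j UNIV Nn Np ?R \<le> \<eta> * Nn k"
      using \<delta> \<open>Nn k < \<delta>\<close> Z[OF s(1)] zk by simp
    have lin: "Dg (Suc j) y ?z (k # vs) = (s - t) *\<^sub>R Dg (Suc j) y ?z (h # vs)"
      unfolding k_def using pd(2)
      by (intro linear_scale[OF linear_multilin_head[OF multilin len]] Z[OF t]) auto
    have "norm (?R vs) \<le> C * Np (?R vs)"
      by (rule C)
    also have "\<dots> \<le> C * (multilin_norm j UNIV Nn Np ?R * ?P)"
      using C(1) pd(2) len Z[OF t] Z[OF s(1)]
      by (intro mult_left_mono multilin_norm_bound[OF Nn Np] multilin_space_diff[OF Np]
          multilin_space_slice multilin) (auto simp: zk)
    also have "\<dots> \<le> C * (\<eta> * Nn k * ?P)"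
      using C(1) R nonneg by (intro mult_left_mono mult_right_mono) auto
    also have "\<dots> = (C * \<eta> * (Nn h * ?P)) * \<bar>s - t\<bar>"
      by (simp add: Nk)
    also have "\<dots> \<le> \<epsilon> * \<bar>s - t\<bar>"
      using \<open>C * \<eta> * (Nn h * ?P) \<le> \<epsilon>\<close> by (rule mult_right_mono) simp
    finally show "norm (Dg j y (z + s *\<^sub>R h) vs - Dg j y ?z vs
        - (s - t) *\<^sub>R Dg (Suc j) y ?z (h # vs)) \<le> \<epsilon> * norm (s - t)"
      by (simp add: zk lin)
  qed
qed

text \<open>
  The mean value inequality along the segment from \<open>z\<close> to \<open>z + h\<close>; convexity of \<open>Z\<close> keeps the
  segment inside \<open>Z\<close>.
\<close>

lemma partial_derivative_remainder:
  fixes Dg :: "nat \<Rightarrow> 'a \<Rightarrow> 'n::euclidean_space \<Rightarrow> 'n list \<Rightarrow> 'p::euclidean_space"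
  assumes Nn: "vector_norm Nn" and Np: "vector_norm Np"
    and pd: "partial_derivatives Nn Np Z m g Dg" "j < m"
    and Z: "convex Z" "z \<in> Z" "z + h \<in> Z" and len: "length vs = j"
    and close: "\<And>x ws. x \<in> Z \<Longrightarrow> Nn (x - z) \<le> Nn h \<Longrightarrow> length ws = Suc j \<Longrightarrow>
      norm (Dg (Suc j) y x ws - Dg (Suc j) y z ws) \<le> e * (\<Prod>v\<leftarrow>ws. Nn v)"
  shows "norm (Dg j y (z + h) vs - Dg j y z vs - Dg (Suc j) y z (h # vs))
    \<le> e * Nn h * (\<Prod>v\<leftarrow>vs. Nn v)"
proof -
  have seg: "z + t *\<^sub>R h \<in> Z" if "t \<in> {0..1}" for t
    using convexD_alt[OF Z, of t] that by (simp add: algebra_simps)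
  have "Nn ((z + t *\<^sub>R h) - z) \<le> Nn h" if "t \<in> {0..1}" for t
    using that by (simp add: vector_norm_scaleR[OF Nn] mult_left_le_one_le vector_norm_nonneg[OF Nn])
  then have "norm (Dg (Suc j) y (z + t *\<^sub>R h) (h # vs) - Dg (Suc j) y (z + 0 *\<^sub>R h) (h # vs))
      \<le> e * Nn h * (\<Prod>v\<leftarrow>vs. Nn v)" if "t \<in> {0..1}" for t
    using close[OF seg[OF that], of "h # vs"] that len by (simp add: mult.assoc)
  then have "norm (Dg j y (z + 1 *\<^sub>R h) vs - Dg j y (z + 0 *\<^sub>R h) vs
      - (1 - 0) *\<^sub>R Dg (Suc j) y (z + 0 *\<^sub>R h) (h # vs))
    \<le> norm (1 - 0 :: real) * (e * Nn h * (\<Prod>v\<leftarrow>vs. Nn v))"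
    by (intro vector_differentiable_bound_linearization[where S = "{0..1}"
          and f' = "\<lambda>t. Dg (Suc j) y (z + t *\<^sub>R h) (h # vs)"
          and f = "\<lambda>t. Dg j y (z + t *\<^sub>R h) vs"]
        partial_derivative_along_segment[OF Nn Np pd len] seg)
      (auto simp: closed_segment_eq_real_ivl)
  then show ?thesis
    by simp
qed

section \<open>Differentiability of the Hammerstein operator\<close>

text \<open>
  The constant is pulled out of the integral of \<open>norm (A y) / C\<close>, which is measurable with \<open>A\<close>,
  before the integrand is compared with \<open>N (A y)\<close>.
\<close>

lemma kernel_norm_bound:
  fixes A :: "'a \<Rightarrow> real^'p^'d"
  assumes "A \<in> borel_measurable M" "C > 0" "\<And>B. norm B \<le> C * N B"
    and "(\<integral>\<^sup>+y. ennreal (N (A y)) \<partial>M) \<le> ennreal I" "0 \<le> I"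
  shows "(\<integral>\<^sup>+y. norm (A y) \<partial>M) \<le> ennreal (C * I)"
proof -
  have "ennreal (norm (A y)) = ennreal C * ennreal (norm (A y) / C)" for y
    using assms(2) by (simp add: ennreal_mult[symmetric])
  then have "(\<integral>\<^sup>+y. norm (A y) \<partial>M) = ennreal C * (\<integral>\<^sup>+y. ennreal (norm (A y) / C) \<partial>M)"
    using assms(1) by (simp add: nn_integral_cmult)
  also have "(\<integral>\<^sup>+y. ennreal (norm (A y) / C) \<partial>M) \<le> (\<integral>\<^sup>+y. ennreal (N (A y)) \<partial>M)"
    using assms(2,3) by (intro nn_integral_mono ennreal_leI) (simp add: pos_divide_le_eq mult.commute)
  also note assms(4)
  also have "ennreal C * ennreal I = ennreal (C * I)"
    using assms(2,5) by (simp add: ennreal_mult)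
  finally show ?thesis
    by (simp add: mult_left_mono)
qed

text \<open>
  All three claims on \<open>D j\<close> have the same pattern: a pointwise estimate of the integrand by a
  multiple of \<open>\<Prod>v\<leftarrow>vs. Nn (v y)\<close>, to which the Fredholm bound is applied. The estimates are
  \<open>bounded_on_graph\<close> for membership in the multilinear maps, \<open>partial_derivative_remainder\<close> for
  differentiability and \<open>uniform_near_graph\<close> for continuity of the derivatives.
\<close>

lemma (in fredholm_kernel) hammerstein_cont_differentiable:
  fixes Dg :: "nat \<Rightarrow> 'a \<Rightarrow> 'n::euclidean_space \<Rightarrow> 'n list \<Rightarrow> real^'p"
  assumes Nn: "vector_norm Nn" and Np: "vector_norm Np" and Nd: "vector_norm Nd"
    and alpha: "0 \<le> \<alpha>" and convex: "convex Z"
    and pd: "partial_derivatives Nn Np Z m g Dg"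
    and ext: "\<And>j. j \<le> m \<Longrightarrow> continuously_extends j Nn Np Z (Dg j)"
  shows "cont_differentiable m
    (holder_space \<alpha> Nn) (holder_norm \<alpha> Nn) (holder_into \<alpha> Nn Z)
    (holder_space \<beta> Nd) (holder_norm \<beta> Nd)
    (hammerstein M k g) (\<lambda>j u vs. fredholm M k (nemytskii Dg j u vs))"
proof -
  let ?X = "holder_space \<alpha> Nn :: ('a \<Rightarrow> 'n) set" and ?NX = "holder_norm \<alpha> Nn :: ('a \<Rightarrow> 'n) \<Rightarrow> real"
  let ?U = "holder_into \<alpha> Nn Z :: ('a \<Rightarrow> 'n) set"
  let ?Y = "holder_space \<beta> Nd :: ('b \<Rightarrow> real^'d) set" and ?NY = "holder_norm \<beta> Nd :: ('b \<Rightarrow> real^'d) \<Rightarrow> real"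
  let ?D = "\<lambda>j u vs. fredholm M k (nemytskii Dg j u vs)"
  let ?at = "\<lambda>vs y. map (\<lambda>v. v y) vs"
  have D0: "Dg 0 y z [] = g y z" if "z \<in> Z" for y z
    using pd that by (simp add: partial_derivatives_def)
  have multilin: "Dg j y z \<in> multilin_space j UNIV Nn UNIV Np" if "j \<le> m" "z \<in> Z" for j y z
    using pd that by (simp add: partial_derivatives_def)
  have X_cont: "continuous_on UNIV v" if "v \<in> ?X" for v
    using holder_space_continuous[OF Nn alpha that] .
  have UX: "u \<in> ?X" and UZ: "u y \<in> Z" if "u \<in> ?U" for u y
    using that by (auto simp: holder_into_def)
  have nem_cont: "continuous_on UNIV (nemytskii Dg j u vs)"
    if "j \<le> m" "u \<in> ?U" "vs \<in> args j ?X" for j u vs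
    using that
    by (intro nemytskii_continuous[OF Nn Np ext multilin X_cont[OF UX] UZ])
      (auto simp: args_def X_cont)
  have prod_at: "(\<Prod>v\<leftarrow>?at vs y. Nn v) \<le> (\<Prod>v\<leftarrow>vs. ?NX v)" if "vs \<in> args j ?X" for vs y j
    using that unfolding map_map comp_def
    by (intro prod_list_mono_nonneg) (auto simp: args_def vector_norm_nonneg[OF Nn] holder_space_sup)
  have prod_at_1: "(\<Prod>v\<leftarrow>?at vs y. Nn v) \<le> 1"
    if vs: "vs \<in> args j ?X" "\<And>v. v \<in> set vs \<Longrightarrow> ?NX v \<le> 1" for vs y j
  proof -
    have "Nn (v y) \<le> 1" if "v \<in> set vs" for v
    proof -
      have "v \<in> ?X"
        using that vs(1) by (auto simp: args_def)
      from holder_space_sup[OF this] vs(2)[OF that] show ?thesis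
        by (rule order_trans)
    qed
    then have "(\<Prod>v\<leftarrow>vs. Nn (v y)) \<le> (\<Prod>v\<leftarrow>vs. 1)"
      by (intro prod_list_mono_nonneg vector_norm_nonneg[OF Nn])
    also have "(\<Prod>v\<leftarrow>vs. 1 :: real) = 1"
      by (induction vs) auto
    finally show ?thesis by (simp add: comp_def)
  qed
  obtain C where "C > 0"
    and C_space: "\<And>w B. continuous_on UNIV w \<Longrightarrow> (\<And>y. norm (w y) \<le> B) \<Longrightarrow> fredholm M k w \<in> ?Y"
    and C_norm: "\<And>w B. continuous_on UNIV w \<Longrightarrow> (\<And>y. norm (w y) \<le> B) \<Longrightarrow>
      ?NY (fredholm M k w) \<le> C * B"
    using fredholm_holder_bound[OF Nd] by metis
  \<comment> \<open>Estimates in the multilinear norm reduce to pointwise ones for arguments in the unit ball.\<close>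
  have norm_bound: "multilin_norm j ?X ?NX ?NY (\<lambda>vs. fredholm M k (W vs)) \<le> C * B"
    if "\<And>vs. vs \<in> args j ?X \<Longrightarrow> continuous_on UNIV (W vs)"
      and "\<And>vs y. vs \<in> args j ?X \<Longrightarrow> norm (W vs y) \<le> B * (\<Prod>v\<leftarrow>?at vs y. Nn v)"
      and "0 \<le> B" for W j B
  proof (rule multilin_norm_le)
    show "0 \<in> ?X" "?NX 0 \<le> 1"
      by (simp_all add: zero_in_holder_space[OF Nn])
    fix vs assume vs: "vs \<in> args j ?X" "\<And>v. v \<in> set vs \<Longrightarrow> ?NX v \<le> 1"
    have "norm (W vs y) \<le> B" for y
      using that(2)[OF vs(1), of y] mult_left_mono[OF prod_at_1[OF vs, of y] that(3)] by simp
    then show "?NY (fredholm M k (W vs)) \<le> C * B"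
      using C_norm that(1)[OF vs(1)] by blast
  qed
  \<comment> \<open>Only values on lists in the carrier count, where the integrals exist and are additive.\<close>
  have norm_cong: "multilin_norm j ?X ?NX ?NY F = multilin_norm j ?X ?NX ?NY G"
    if "\<And>vs. vs \<in> args j ?X \<Longrightarrow> F vs = G vs" for F G j
    unfolding multilin_norm_def using that by (intro SUP_cong) auto

  have space: "?D j u \<in> multilin_space j ?X ?NX ?Y ?NY" if j: "j \<le> m" and u: "u \<in> ?U" for j u
  proof -
    obtain B where B: "\<And>y vs. length vs = j \<Longrightarrow> norm (Dg j y (u y) vs) \<le> B * (\<Prod>v\<leftarrow>vs. Nn v)"
      using bounded_on_graph[OF Nn Np ext[OF j] multilin[OF j] compact_domain X_cont[OF UX[OF u]]
          UZ[OF u]] by blast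
    have nem_bound: "norm (nemytskii Dg j u vs y) \<le> \<bar>B\<bar> * (\<Prod>v\<leftarrow>vs. ?NX v)"
      if vs: "vs \<in> args j ?X" for vs y
    proof -
      have "norm (nemytskii Dg j u vs y) \<le> B * (\<Prod>v\<leftarrow>?at vs y. Nn v)"
        unfolding nemytskii_def using vs by (intro B) (simp add: args_def)
      also have "\<dots> \<le> \<bar>B\<bar> * (\<Prod>v\<leftarrow>vs. ?NX v)"
        by (intro mult_mono prod_at[OF vs] prod_list_vector_norm_nonneg[OF Nn]) auto
      finally show ?thesis .
    qed
    have in_Y: "?D j u vs \<in> ?Y" if "vs \<in> args j ?X" for vs
      using C_space[OF nem_cont[OF j u that] nem_bound[OF that]] .
    have bound: "?NY (?D j u vs) \<le> (C * \<bar>B\<bar>) * (\<Prod>v\<leftarrow>vs. ?NX v)" if "vs \<in> args j ?X" for vs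
      using C_norm[OF nem_cont[OF j u that] nem_bound[OF that]] by (simp add: mult.assoc)
    have linear: "?D j u (vs[i := r *\<^sub>R a + s *\<^sub>R b])
        = r *\<^sub>R ?D j u (vs[i := a]) + s *\<^sub>R ?D j u (vs[i := b])"
      if vs: "vs \<in> args j ?X" and i: "i < j" and a: "a \<in> ?X" and b: "b \<in> ?X" for vs i a b r s
    proof -
      have upd: "vs[i := c] \<in> args j ?X" if "c \<in> ?X" for c
        using vs that set_update_subset_insert[of vs i c] by (auto simp: args_def)
      have "nemytskii Dg j u (vs[i := r *\<^sub>R a + s *\<^sub>R b])
          = (\<lambda>y. r *\<^sub>R nemytskii Dg j u (vs[i := a]) y + s *\<^sub>R nemytskii Dg j u (vs[i := b]) y)"
        using vs i multilin_update[OF multilin[OF j UZ[OF u]], of "?at vs _" i]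
        by (auto simp: nemytskii_def map_update scaleR_fun_def args_def)
      then show ?thesis
        using fredholm_linear[OF nem_cont[OF j u upd[OF a]] nem_cont[OF j u upd[OF b]]] by simp
    qed
    show ?thesis
      unfolding multilin_space_def using in_Y linear bound by blast
  qed

  have derivative: "frechet_within ?X ?NX ?U (multilin_norm j ?X ?NX ?NY) (?D j)
      (\<lambda>h vs. ?D (Suc j) u (h # vs)) u" if j: "j < m" and u: "u \<in> ?U" for j u
    unfolding frechet_within_def
  proof (intro allI impI)
    fix \<epsilon> :: real assume "\<epsilon> > 0"
    then have "\<epsilon> / C > 0"
      using \<open>C > 0\<close> by simp
    obtain d where "d > 0" and d: "\<And>y z vs. z \<in> Z \<Longrightarrow> Nn (z - u y) < d \<Longrightarrow> length vs = Suc j \<Longrightarrow>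
        norm (Dg (Suc j) y z vs - Dg (Suc j) y (u y) vs) \<le> \<epsilon> / C * (\<Prod>v\<leftarrow>vs. Nn v)"
      using uniform_near_graph[OF Nn Np ext compact_domain X_cont[OF UX[OF u]] UZ[OF u] \<open>\<epsilon> / C > 0\<close>]
        j by (metis Suc_leI)
    have "multilin_norm j ?X ?NX ?NY (?D j (u + h) - ?D j u - (\<lambda>vs. ?D (Suc j) u (h # vs)))
        \<le> \<epsilon> * ?NX h" if h: "h \<in> ?X" "u + h \<in> ?U" "?NX h < d" for h
    proof -
      let ?W = "\<lambda>vs y. nemytskii Dg j (u + h) vs y - nemytskii Dg j u vs y
        - nemytskii Dg (Suc j) u (h # vs) y"
      have h_le: "Nn (h y) \<le> ?NX h" for y
        by (rule holder_space_sup[OF h(1)])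
      have "0 \<le> ?NX h"
        using h_le vector_norm_nonneg[OF Nn] order_trans by blast
      have cons: "h # vs \<in> args (Suc j) ?X" if "vs \<in> args j ?X" for vs
        using that h(1) by (simp add: args_def)
      have cont: "continuous_on UNIV (nemytskii Dg j (u + h) vs)"
        "continuous_on UNIV (nemytskii Dg j u vs)"
        "continuous_on UNIV (nemytskii Dg (Suc j) u (h # vs))" if "vs \<in> args j ?X" for vs
        using j that by (auto intro!: nem_cont u h(2) cons)
      have W_cont: "continuous_on UNIV (?W vs)" if "vs \<in> args j ?X" for vs
        by (intro continuous_on_diff cont that)
      have W_bound: "norm (?W vs y) \<le> (\<epsilon> / C * ?NX h) * (\<Prod>v\<leftarrow>?at vs y. Nn v)"
        if vs: "vs \<in> args j ?X" for vs y
      proof -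
        have "norm (Dg j y (u y + h y) (?at vs y) - Dg j y (u y) (?at vs y)
            - Dg (Suc j) y (u y) (h y # ?at vs y)) \<le> \<epsilon> / C * Nn (h y) * (\<Prod>v\<leftarrow>?at vs y. Nn v)"
        proof (rule partial_derivative_remainder[OF Nn Np pd j convex UZ[OF u]])
          show "u y + h y \<in> Z"
            using UZ[OF h(2), of y] by simp
          show "length (?at vs y) = j"
            using vs by (simp add: args_def)
          fix x and ws :: "'n list"
          assume "x \<in> Z" "Nn (x - u y) \<le> Nn (h y)" "length ws = Suc j"
          then show "norm (Dg (Suc j) y x ws - Dg (Suc j) y (u y) ws) \<le> \<epsilon> / C * (\<Prod>v\<leftarrow>ws. Nn v)"
            using h_le[of y] h(3) by (intro d) auto
        qed
        also have "\<dots> \<le> (\<epsilon> / C * ?NX h) * (\<Prod>v\<leftarrow>?at vs y. Nn v)"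
          using \<open>\<epsilon> / C > 0\<close> h_le
          by (intro mult_right_mono mult_left_mono prod_list_vector_norm_nonneg[OF Nn]) auto
        finally show ?thesis
          by (simp add: nemytskii_def)
      qed
      have "0 \<le> \<epsilon> / C * ?NX h"
        by (intro mult_nonneg_nonneg less_imp_le[OF \<open>\<epsilon> / C > 0\<close>] \<open>0 \<le> ?NX h\<close>)
      then have "multilin_norm j ?X ?NX ?NY (\<lambda>vs. fredholm M k (?W vs)) \<le> C * (\<epsilon> / C * ?NX h)"
        by (intro norm_bound W_cont W_bound)
      moreover have "(?D j (u + h) - ?D j u - (\<lambda>vs. ?D (Suc j) u (h # vs))) vs
          = fredholm M k (?W vs)" if "vs \<in> args j ?X" for vs
        using fredholm_diff[OF cont(1,2)[OF that]]
          fredholm_diff[OF continuous_on_diff[OF cont(1,2)[OF that]] cont(3)[OF that]] by simp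
      ultimately show ?thesis
        using norm_cong[of j "?D j (u + h) - ?D j u - (\<lambda>vs. ?D (Suc j) u (h # vs))"
            "\<lambda>vs. fredholm M k (?W vs)"] \<open>C > 0\<close> by simp
    qed
    then show "\<exists>\<delta>>0. \<forall>h\<in>?X. u + h \<in> ?U \<and> ?NX h < \<delta> \<longrightarrow>
        multilin_norm j ?X ?NX ?NY (?D j (u + h) - ?D j u - (\<lambda>vs. ?D (Suc j) u (h # vs)))
          \<le> \<epsilon> * ?NX h"
      using \<open>d > 0\<close> by blast
  qed

  have continuous: "norm_continuous_on ?U ?NX (multilin_norm j ?X ?NX ?NY) (?D j)"
    if j: "j \<le> m" for j
    unfolding norm_continuous_on_def
  proof (intro ballI allI impI)
    fix u and \<epsilon> :: real assume u: "u \<in> ?U" and "\<epsilon> > 0"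
    then have "\<epsilon> / (2 * C) > 0"
      using \<open>C > 0\<close> by simp
    obtain d where "d > 0" and d: "\<And>y z vs. z \<in> Z \<Longrightarrow> Nn (z - u y) < d \<Longrightarrow> length vs = j \<Longrightarrow>
        norm (Dg j y z vs - Dg j y (u y) vs) \<le> \<epsilon> / (2 * C) * (\<Prod>v\<leftarrow>vs. Nn v)"
      using uniform_near_graph[OF Nn Np ext[OF j] compact_domain X_cont[OF UX[OF u]] UZ[OF u]
          \<open>\<epsilon> / (2 * C) > 0\<close>] by metis
    have "multilin_norm j ?X ?NX ?NY (?D j u' - ?D j u) < \<epsilon>"
      if u': "u' \<in> ?U" "?NX (u' - u) < d" for u'
    proof -
      let ?W = "\<lambda>vs y. nemytskii Dg j u' vs y - nemytskii Dg j u vs y"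
      have "u' - u \<in> ?X"
        by (rule holder_space_diff[OF Nn UX[OF u'(1)] UX[OF u]])
      then have "Nn (u' y - u y) < d" for y
        using holder_space_sup[of "u' - u" \<alpha> Nn y] u'(2) by simp
      then have W_bound: "norm (?W vs y) \<le> \<epsilon> / (2 * C) * (\<Prod>v\<leftarrow>?at vs y. Nn v)"
        if "vs \<in> args j ?X" for vs y
        using that unfolding nemytskii_def by (intro d UZ[OF u'(1)]) (auto simp: args_def)
      have "multilin_norm j ?X ?NX ?NY (\<lambda>vs. fredholm M k (?W vs)) \<le> C * (\<epsilon> / (2 * C))"
        using less_imp_le[OF \<open>\<epsilon> / (2 * C) > 0\<close>]
        by (intro norm_bound continuous_on_diff nem_cont W_bound j u u'(1))
      moreover have "(?D j u' - ?D j u) vs = fredholm M k (?W vs)" if "vs \<in> args j ?X" for vs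
        using fredholm_diff[OF nem_cont[OF j u'(1) that] nem_cont[OF j u that]] by simp
      ultimately show ?thesis
        using norm_cong[of j "?D j u' - ?D j u" "\<lambda>vs. fredholm M k (?W vs)"] \<open>C > 0\<close> \<open>\<epsilon> > 0\<close>
        by simp
    qed
    then show "\<exists>\<delta>>0. \<forall>u'\<in>?U. ?NX (u' - u) < \<delta> \<longrightarrow>
        multilin_norm j ?X ?NX ?NY (?D j u' - ?D j u) < \<epsilon>"
      using \<open>d > 0\<close> by blast
  qed

  have "?D 0 u [] = hammerstein M k g u" if "u \<in> ?U" for u
    by (simp add: fredholm_def nemytskii_def hammerstein_def D0 UZ[OF that])
  with space derivative continuous show ?thesis
    unfolding cont_differentiable_def by blast
qed

theorem theorem3p11:
  fixes M :: "'a::metric_space measure"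
    and k :: "'b::metric_space \<Rightarrow> 'a \<Rightarrow> real^'p^'d"
    and g :: "'a \<Rightarrow> real^'n \<Rightarrow> real^'p"
    and Dg :: "nat \<Rightarrow> 'a \<Rightarrow> real^'n \<Rightarrow> (real^'n) list \<Rightarrow> real^'p"
    and Z :: "(real^'n) set"
    and Nn :: "real^'n \<Rightarrow> real" and Np :: "real^'p \<Rightarrow> real" and Nd :: "real^'d \<Rightarrow> real"
    and Ndp :: "real^'p^'d \<Rightarrow> real"
    and ht :: "'b \<times> 'b \<Rightarrow> real"
    and m :: nat and \<alpha> \<beta> :: real
  assumes norms: "vector_norm Nn" "vector_norm Np" "vector_norm Nd" "vector_norm Ndp"
    and compatible: "\<And>A w. Nd (A *v w) \<le> Ndp A * Np w"
    and Omega: "compact (UNIV :: 'a set)"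
    and M: "space M = UNIV" "sets borel \<subseteq> sets M" "emeasure M UNIV < \<infinity>"
    and alpha: "0 \<le> \<alpha>" "\<alpha> \<le> 1"
    and beta: "0 < \<beta>" "\<beta> \<le> 1"
    and Z: "Z \<noteq> {}" "convex Z"
    and ht: "continuous_on UNIV ht" "\<And>q. 0 \<le> ht q" "bounded (range ht)"
    and a: "\<And>x x0. (\<integral>\<^sup>+y. ennreal (Ndp (k x y - k x0 y)) \<partial>M)
                      \<le> ennreal (ht (x, x0) * dist x x0 powr \<beta>)"
    and b: "\<And>x. k x \<in> borel_measurable M"
           "(SUP \<xi>. \<integral>\<^sup>+y. ennreal (Ndp (k \<xi> y)) \<partial>M) < \<infinity>"
    and c: "partial_derivatives Nn Np Z m g Dg"
           "\<And>j. j \<le> m \<Longrightarrow> continuously_extends j Nn Np Z (Dg j)"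
  shows "cont_differentiable m
           (holder_space \<alpha> Nn) (holder_norm \<alpha> Nn) (holder_into \<alpha> Nn Z)
           (holder_space \<beta> Nd) (holder_norm \<beta> Nd)
           (hammerstein M k g)
           (\<lambda>j u vs. fredholm M k (nemytskii Dg j u vs))"
proof -
  obtain C where C: "C > 0" "\<And>A. norm A \<le> C * Ndp A"
    using vector_norm_equivalent[OF norms(4)] by metis
  define S where "S = enn2real (SUP \<xi>. \<integral>\<^sup>+y. ennreal (Ndp (k \<xi> y)) \<partial>M)"
  have S: "(\<integral>\<^sup>+y. ennreal (Ndp (k x y)) \<partial>M) \<le> ennreal S" for x
  proof -
    have "(\<integral>\<^sup>+y. ennreal (Ndp (k x y)) \<partial>M) \<le> (SUP \<xi>. \<integral>\<^sup>+y. ennreal (Ndp (k \<xi> y)) \<partial>M)"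
      by (rule SUP_upper) simp
    also have "\<dots> = ennreal S"
      using b(2) by (simp add: S_def)
    finally show ?thesis .
  qed
  obtain H where H: "\<And>q. ht q \<le> H"
    using ht(3) by (auto simp: bounded_iff) (metis abs_le_D1)
  have "0 \<le> S" "0 \<le> H"
    using order_trans[OF ht(2) H] by (auto simp: S_def)
  interpret fredholm_kernel M k "C * (S + H)" \<beta>
  proof
    show "\<beta> \<noteq> 0" "0 \<le> C * (S + H)"
      using beta C(1) \<open>0 \<le> S\<close> \<open>0 \<le> H\<close> by auto
    show "(\<integral>\<^sup>+y. norm (k x y) \<partial>M) \<le> ennreal (C * (S + H))" for x
      using \<open>0 \<le> S\<close> \<open>0 \<le> H\<close>
      by (intro kernel_norm_bound[OF b(1) C] order_trans[OF S] ennreal_leI) auto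
    have "(\<integral>\<^sup>+y. ennreal (Ndp (k x y - k x' y)) \<partial>M) \<le> ennreal ((S + H) * dist x x' powr \<beta>)" for x x'
    proof -
      have "ht (x, x') * dist x x' powr \<beta> \<le> (S + H) * dist x x' powr \<beta>"
        using H[of "(x, x')"] \<open>0 \<le> S\<close> by (intro mult_right_mono) auto
      then show ?thesis
        by (intro order_trans[OF a] ennreal_leI)
    qed
    from kernel_norm_bound[OF borel_measurable_diff[OF b(1) b(1)] C this]
    show "(\<integral>\<^sup>+y. norm (k x y - k x' y) \<partial>M) \<le> ennreal (C * (S + H) * dist x x' powr \<beta>)" for x x'
      using \<open>0 \<le> S\<close> \<open>0 \<le> H\<close> by (simp add: mult.assoc)
  qed (use Omega M b in auto)
  show ?thesis
    by (rule hammerstein_cont_differentiable[OF norms(1-3) alpha(1) Z(2) c])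
qed

end
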